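(* Assume there are constants $\gamma_t\ge 0$ ($t=0,\dots,T-1$) with $|C_t(x)-C_t(y)|\le\gamma_t|x-y|$ for all $x,y$. Then for every $x$ with $z_{k-1}<x\le z_k$, $z_k\in Z_\theta$, $$-\bar\omega_0(z_k)\le v_0(x)-(V_0(x)-c_0x)\le\bar\epsilon_0(z_k).$$
   Context: Model. Fix an integer horizon $T\ge 2$, a discount factor $\alpha\in(0,1]$, and for $t=0,\dots,T-1$: unit ordering costs $c_t\in\mathbb R$, a salvage coefficient $c_T\in\mathbb R$, setup costs $K_t\ge 0$, functions $G_t:\mathbb R\to\mathbb R$, and independent nonnegative random demands $D_0,\dots,D_{T-1}$ with right-continuous distribution functions $F_t$ and finite means; all expectations appearing are assumed finite. Let $\delta(z)=1$ for $z>0$, $\delta(0)=0$. Put $C_t(y)=(c_t-\alpha c_{t+1})y+G_t(y)+\alpha c_{t+1}E[D_t]$. Standing assumptions: (i) each $C_t$ is convex with $C_t(y)\to+\infty$ as $|y|\to\infty$; (ii) $K_t\ge \alpha K_{t+1}$ for $t=0,\dots,T-2$. Optimal costs: $v_T(x)=-c_Tx$, $v_t(x)=\min_{y\ge x}\{K_t\delta(y-x)+c_t(y-x)+G_t(y)+\alpha E[v_{t+1}(y-D_t)]\}$. Grid construction. Fix $\theta>0$, $z_m=m\theta$, $Z_\theta=\{z_m:m\in\mathbb Z\}$, $f_t(n)=F_t(z_{n+1})-F_t(z_n)$ ($n\ge -1$). $C^m_t=\min\{y: C_t(y)=\min_x C_t(x)\}$; with $z_{n_0}<C^m_t\le z_{n_0+1}$,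 $S^U_t=\min\{z_m\in Z_\theta: z_m\ge C^m_t,\ C_t(z_m)>C_t(z_{n_0})+K_t\}$. $s_{T-1}$ is a point with $s_{T-1}\le C^m_{T-1}$, $C_{T-1}(s_{T-1})=C_{T-1}(C^m_{T-1})+K_{T-1}$; $\bar I_{T-1}=s_{T-1}$. For $t=T-2,\dots,0$: $I_t=\max\{z_m\in Z_\theta: z_m<\min(\bar I_{t+1}-\theta,C^m_t)\}$, $\bar I_t=\max\{z_m\in Z_\theta: z_m\le I_t,\ C_t(z_m)>C_t(I_t)+K_t\}+\theta$. $H_{T-1}=C_{T-1}$, $S_{T-1}=C^m_{T-1}$; $V_t(y)=H_t(S_t)+K_t$ for $y<s_t$, $V_t(y)=H_t(y)$ for $y\ge s_t$. For $t=T-2,\dots,0$: $H_t(y)=C_t(y)+\alpha\sum_{n=-1}^\infty V_{t+1}(y-z_n)f_t(n)$; $S_t=\max\{z_m\in Z_\theta: I_t\le z_m\le S^U_t,\ H_t(z_m)=\min\{H_t(z_n):z_n\in Z_\theta, I_t\le z_n\le S^U_t\}\}$; $s_t=S_t$ if $K_t=0$, else $s_t=\min\{z_m\in Z_\theta:\bar I_t\le z_m\le S_t,\ H_t(z_m)\le H_t(S_t)+K_t\}$. Estimate functions. $\psi_{T-1}(x,y)=\bar\psi_{T-1}(x,y)=\gamma_{T-1}x$; $\varphi_{T-1}(x,y)=\bar\varphi_{T-1}(x,y)=0$ if $y<s_{T-1}$ and $=\gamma_{T-1}x$ if $y\ge s_{T-1}$. For $t=0,\dots,T-2$, with $n$ the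 integer such that $z_{n-1}\le y-s_{t+1}<z_n$: $\psi_t(x,y)=\gamma_tx$ if $y<s_{t+1}-\theta$, else $\psi_t(x,y)=\gamma_tx+\alpha\sum_{m=-1}^{n-1}\varphi_{t+1}(x,y-z_m)f_t(m)$; $\varphi_t(x,y)=0$ if $y<s_t$, $=\psi_t(y-s_t,y)$ if $y\ge s_t$ and $y-x<s_t$, $=\psi_t(x,y)$ if $y\ge s_t$ and $y-x\ge s_t$. Likewise $\bar\psi_t(x,y)=\gamma_tx$ if $y<s_{t+1}-\theta$, else $\bar\psi_t(x,y)=\gamma_tx+\alpha\sum_{m=-1}^{n-1}\bar\varphi_{t+1}(x,y-z_m)f_t(m)$; $\bar\varphi_t(x,y)=0$ if $y<s_t$, $=\bar\psi_t(y-s_t+\theta,y)$ if $y\ge s_t$ and $y-x<s_t$, $=\bar\psi_t(x,y)$ if $y\ge s_t$ and $y-x\ge s_t$. Error-bound functions. $\omega_{T-1}\equiv\bar\omega_{T-1}\equiv 0$, $\eta_{T-1}=0$. For $t=T-2,\dots,0$: $\omega_t(x)=\psi_t(\theta,x)-\gamma_t\theta+\alpha\sum_{n=-1}^\infty\bar\omega_{t+1}(x-z_n)f_t(n)$; $\eta_t=\bar\psi_t(\theta,S^U_t)+\omega_t(S^U_t)$; $\bar\omega_t(x)=\eta_t$ if $x\le S^U_t$ and $\bar\omega_t(x)=\max(\eta_t,\omega_t(x))$ if $x>S^U_t$. For $z_k\in Z_\theta$: $\bar\epsilon_{T-2}(z_k)=\alpha\gamma_{T-1}\theta$ and for $t=0,\dots,T-3$,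 $\bar\epsilon_t(z_k)=\alpha^{T-1-t}\gamma_{T-1}\theta+\sum_{i=0}^{T-3-t}2\alpha^i[\bar\psi_{t+i}(\theta,\max(\lambda_t(i),S_{t+i}))-\gamma_{t+i}\theta]$, with $\lambda_t(0)=z_k$, $\lambda_t(i)=\max(\lambda_t(i-1),S_{t+i-1})+\theta$ for $i=1,\dots,T-3-t$. *)

theory Defs
  imports "HOL-Probability.Probability"
begin

text \<open>Model data of the finite-horizon inventory problem with setupK costs.
  Periods are t = 0, ..., hor - 1; cst t is c_t (cst hor is the salvage
  coefficient c_T), setupK t is K_t, Gf t is G_t, dem t is the distribution
  (a probability measure on the reals) of the demand D_t, theta is the grid
  width and gam t are the Lipschitz constants gamma_t.\<close>

record invmodel =
  hor :: nat
  alpha :: real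
  cst :: "nat \<Rightarrow> real"
  setupK :: "nat \<Rightarrow> real"
  Gf :: "nat \<Rightarrow> real \<Rightarrow> real"
  dem :: "nat \<Rightarrow> real measure"
  theta :: real
  gam :: "nat \<Rightarrow> real"

definition delta :: "real \<Rightarrow> real" where
  "delta z = (if z > 0 then 1 else 0)"

definition Emean :: "invmodel \<Rightarrow> nat \<Rightarrow> real" where
  "Emean M t = (\<integral>d. d \<partial>dem M t)"

definition Ccost :: "invmodel \<Rightarrow> nat \<Rightarrow> real \<Rightarrow> real" where
  "Ccost M t y = (cst M t - alpha M * cst M (Suc t)) * y + Gf M t y
     + alpha M * cst M (Suc t) * Emean M t"

text \<open>Optimal costs: vaux M n is v_{T-n}.\<close>
primrec vaux :: "invmodel \<Rightarrow> nat \<Rightarrow> real \<Rightarrow> real" where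
  "vaux M 0 = (\<lambda>x. - cst M (hor M) * x)"
| "vaux M (Suc n) = (\<lambda>x. let t = hor M - Suc n in
     Inf ((\<lambda>y. setupK M t * delta (y - x) + cst M t * (y - x) + Gf M t y
               + alpha M * (\<integral>d. vaux M n (y - d) \<partial>dem M t)) ` {x..}))"

definition vopt :: "invmodel \<Rightarrow> nat \<Rightarrow> real \<Rightarrow> real" where
  "vopt M t = vaux M (hor M - t)"

definition zg :: "invmodel \<Rightarrow> int \<Rightarrow> real" where
  "zg M m = of_int m * theta M"

definition Zgrid :: "invmodel \<Rightarrow> real set" where
  "Zgrid M = range (zg M)"

definition fprob :: "invmodel \<Rightarrow> nat \<Rightarrow> int \<Rightarrow> real" where
  "fprob M t n = measure (dem M t) {..zg M (n + 1)} - measure (dem M t) {..zg M n}"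

definition sum_from_m1 :: "(int \<Rightarrow> real) \<Rightarrow> real" where
  "sum_from_m1 g = (\<Sum>j. g (int j - 1))"

definition Cmin :: "invmodel \<Rightarrow> nat \<Rightarrow> real" where
  "Cmin M t = Inf {y. \<forall>x. Ccost M t y \<le> Ccost M t x}"

definition zn0 :: "invmodel \<Rightarrow> nat \<Rightarrow> real" where
  "zn0 M t = (THE z. z \<in> Zgrid M \<and> z < Cmin M t \<and> Cmin M t \<le> z + theta M)"

definition SU :: "invmodel \<Rightarrow> nat \<Rightarrow> real" where
  "SU M t = Inf {z \<in> Zgrid M. z \<ge> Cmin M t \<and> Ccost M t z > Ccost M t (zn0 M t) + setupK M t}"

definition sT1 :: "invmodel \<Rightarrow> real" where
  "sT1 M = (SOME s. s \<le> Cmin M (hor M - 1) \<and>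
      Ccost M (hor M - 1) s = Ccost M (hor M - 1) (Cmin M (hor M - 1)) + setupK M (hor M - 1))"

definition Ilow_of :: "invmodel \<Rightarrow> nat \<Rightarrow> real \<Rightarrow> real" where
  "Ilow_of M t Ibnext = Sup {z \<in> Zgrid M. z < min (Ibnext - theta M) (Cmin M t)}"

text \<open>Ibaux M n is \<bar>I_{T-1-n}\<close>
primrec Ibaux :: "invmodel \<Rightarrow> nat \<Rightarrow> real" where
  "Ibaux M 0 = sT1 M"
| "Ibaux M (Suc n) = (let t = hor M - Suc (Suc n); I = Ilow_of M t (Ibaux M n) in
     Sup {z \<in> Zgrid M. z \<le> I \<and> Ccost M t z > Ccost M t I + setupK M t} + theta M)"

definition Ibar :: "invmodel \<Rightarrow> nat \<Rightarrow> real" where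
  "Ibar M t = Ibaux M (hor M - 1 - t)"

definition Ilow :: "invmodel \<Rightarrow> nat \<Rightarrow> real" where
  "Ilow M t = Ilow_of M t (Ibar M (Suc t))"

text \<open>HSaux M n = (H_t, S_t, s_t) for t = T-1-n\<close>
primrec HSaux :: "invmodel \<Rightarrow> nat \<Rightarrow> (real \<Rightarrow> real) \<times> real \<times> real" where
  "HSaux M 0 = (Ccost M (hor M - 1), Cmin M (hor M - 1), sT1 M)"
| "HSaux M (Suc n) = (let t = hor M - Suc (Suc n) in
     case HSaux M n of (H', S', s') \<Rightarrow>
       let V' = (\<lambda>y. if y < s' then H' S' + setupK M (Suc t) else H' y);
           H = (\<lambda>y. Ccost M t y + alpha M * sum_from_m1 (\<lambda>m. V' (y - zg M m) * fprob M t m));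
           G = {z \<in> Zgrid M. Ilow M t \<le> z \<and> z \<le> SU M t};
           S = Max {z \<in> G. \<forall>w\<in>G. H z \<le> H w};
           s = (if setupK M t = 0 then S
                else Min {z \<in> Zgrid M. Ibar M t \<le> z \<and> z \<le> S \<and> H z \<le> H S + setupK M t})
       in (H, S, s))"

definition Hf :: "invmodel \<Rightarrow> nat \<Rightarrow> real \<Rightarrow> real" where
  "Hf M t = fst (HSaux M (hor M - 1 - t))"
definition Sf :: "invmodel \<Rightarrow> nat \<Rightarrow> real" where
  "Sf M t = fst (snd (HSaux M (hor M - 1 - t)))"
definition sf :: "invmodel \<Rightarrow> nat \<Rightarrow> real" where
  "sf M t = snd (snd (HSaux M (hor M - 1 - t)))"

definition Vf :: "invmodel \<Rightarrow> nat \<Rightarrow> real \<Rightarrow> real" where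
  "Vf M t y = (if y < sf M t then Hf M t (Sf M t) + setupK M t else Hf M t y)"

definition nidx :: "invmodel \<Rightarrow> real \<Rightarrow> int" where
  "nidx M u = (THE n. zg M (n - 1) \<le> u \<and> u < zg M n)"

text \<open>Estimate functions: estaux M b n = (psi_t, phi_t) for t = T-1-n;
  b = 0 gives psi/phi, b = theta gives the barred versions.\<close>
primrec estaux :: "invmodel \<Rightarrow> real \<Rightarrow> nat \<Rightarrow>
    (real \<Rightarrow> real \<Rightarrow> real) \<times> (real \<Rightarrow> real \<Rightarrow> real)" where
  "estaux M b 0 = ((\<lambda>x y. gam M (hor M - 1) * x),
                   (\<lambda>x y. if y < sf M (hor M - 1) then 0 else gam M (hor M - 1) * x))"
| "estaux M b (Suc n) = (let t = hor M - Suc (Suc n); phi' = snd (estaux M b n);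
     psi = (\<lambda>x y. if y < sf M (Suc t) - theta M then gam M t * x
                  else gam M t * x + alpha M *
                    (\<Sum>m\<in>{-1..nidx M (y - sf M (Suc t)) - 1}. phi' x (y - zg M m) * fprob M t m));
     phi = (\<lambda>x y. if y < sf M t then 0
                  else if y - x < sf M t then psi (y - sf M t + b) y else psi x y)
   in (psi, phi))"

definition psi :: "invmodel \<Rightarrow> nat \<Rightarrow> real \<Rightarrow> real \<Rightarrow> real" where
  "psi M t = fst (estaux M 0 (hor M - 1 - t))"
definition psibar :: "invmodel \<Rightarrow> nat \<Rightarrow> real \<Rightarrow> real \<Rightarrow> real" where
  "psibar M t = fst (estaux M (theta M) (hor M - 1 - t))"

text \<open>Error bound functions: omaux M n = (omega_t, omegabar_t, eta_t), t = T-1-n\<close>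
primrec omaux :: "invmodel \<Rightarrow> nat \<Rightarrow> (real \<Rightarrow> real) \<times> (real \<Rightarrow> real) \<times> real" where
  "omaux M 0 = ((\<lambda>x. 0), (\<lambda>x. 0), 0)"
| "omaux M (Suc n) = (let t = hor M - Suc (Suc n); wb' = fst (snd (omaux M n));
     w = (\<lambda>x. psi M t (theta M) x - gam M t * theta M
              + alpha M * sum_from_m1 (\<lambda>m. wb' (x - zg M m) * fprob M t m));
     eta = psibar M t (theta M) (SU M t) + w (SU M t);
     wb = (\<lambda>x. if x \<le> SU M t then eta else max eta (w x))
   in (w, wb, eta))"

definition omegabar :: "invmodel \<Rightarrow> nat \<Rightarrow> real \<Rightarrow> real" where
  "omegabar M t = fst (snd (omaux M (hor M - 1 - t)))"

primrec lam :: "invmodel \<Rightarrow> nat \<Rightarrow> real \<Rightarrow> nat \<Rightarrow> real" where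
  "lam M t z 0 = z"
| "lam M t z (Suc i) = max (lam M t z i) (Sf M (t + i)) + theta M"

definition epsbar :: "invmodel \<Rightarrow> nat \<Rightarrow> real \<Rightarrow> real" where
  "epsbar M t z = alpha M ^ (hor M - 1 - t) * gam M (hor M - 1) * theta M
     + (\<Sum>i<hor M - 2 - t. 2 * alpha M ^ i *
          (psibar M (t + i) (theta M) (max (lam M t z i) (Sf M (t + i))) - gam M (t + i) * theta M))"

end

theory Submission
  imports Defs
begin

text \<open>On the grid the approximate problem is an exact discrete inventory problem, so there H_t is
  K_t-convex by Scarf's argument and (s_t, S_t) is optimal for it. Rounding a demand down to the
  grid moves the inventory level by at most theta, and the functions psi, phi (and their barred
  versions) bound the resulting change of H_t and V_t: upward increments by the plain versions,
  downward increments starting at a grid point by the barred ones. Every estimate is stated at an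
  arbitrary grid point above the level in question, which makes it stable under the recursion
  without any monotonicity of the estimate functions. Backward induction then accumulates the
  errors: for the lower bound an arbitrary order-up-to level y \<le> SU_t is compared with the grid
  points just below y and just below x; for the upper bound the approximate policy is used in
  the true problem.\<close>

section \<open>K-convexity and (s, S) policies\<close>

text \<open>The obstacle is the jump of V_t at s_t: for t < T-1 the grid only provides H_t(s_t)
  \<le> H_t(S_t) + K_t, so V_t may drop at s_t when read from left to right and has no modulus of
  continuity in the usual sense. The drop is harmless for upward increments. For downward increments
  it is controlled at the grid point s_t - theta, where H_t is at least H_t(S_t) + K_t; this costs
  one more cell, which is the theta added in the barred functions.

  Directions matter because demands are rounded down strictly: the approximate level y - rd d lies
  above the true level y - d. For fixed y the lower bound needs increments of V_{t+1} from y - d up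
  to y - rd d, hence the plain functions in omega_t; the upper bound needs the reverse, hence the
  doubled barred functions in epsilon. The barred term in eta_t pays for moving a level to the grid,
  since (s_t, S_t) is known to be optimal only against grid points.

  In period T-1 nothing is rounded and s is an exact root, so V is Lipschitz and equals the true
  cost up to the linear term; errors start one period earlier.\<close>

text \<open>Scarf's K-convexity, cleared of denominators and relativised to a set of points so that it
  applies both to the real line and to the grid.\<close>

definition kconvex_on :: "real set \<Rightarrow> real \<Rightarrow> (real \<Rightarrow> real) \<Rightarrow> bool" where
  "kconvex_on A K h \<longleftrightarrow> (\<forall>w\<in>A. \<forall>x\<in>A. \<forall>y\<in>A. w < x \<longrightarrow> x < y \<longrightarrow>
     (y - w) * h x \<le> (y - x) * h w + (x - w) * (K + h y))"

lemma kconvex_onD: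
  "\<lbrakk>kconvex_on A K h; w \<in> A; x \<in> A; y \<in> A; w < x; x < y\<rbrakk> \<Longrightarrow>
     (y - w) * h x \<le> (y - x) * h w + (x - w) * (K + h y)"
  unfolding kconvex_on_def by blast

lemma kconvex_on_subset: "kconvex_on A K h \<Longrightarrow> B \<subseteq> A \<Longrightarrow> kconvex_on B K h"
  unfolding kconvex_on_def by blast

lemma convex_on_imp_kconvex_on:
  assumes "convex_on UNIV h" "0 \<le> K"
  shows "kconvex_on A K h"
  unfolding kconvex_on_def
proof (intro ballI impI)
  fix w x y :: real assume *: "w < x" "x < y"
  define u where "u = (x - w) / (y - w)"
  have u: "0 \<le> u" "u \<le> 1" using * by (auto simp: u_def field_simps)
  have "u * (y - w) = x - w" using * by (simp add: u_def)
  then have x: "x = (1 - u) * w + u * y" by (simp add: algebra_simps)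
  have "h x \<le> (1 - u) * h w + u * h y"
    using convex_onD[OF assms(1) u, of w y] x by simp
  then have "(y - w) * h x \<le> (y - w) * ((1 - u) * h w + u * h y)"
    using * by (intro mult_left_mono) auto
  also have "\<dots> = (y - x) * h w + (x - w) * h y"
  proof -
    have "(y - w) * u = x - w" using * by (simp add: u_def)
    moreover have "(y - w) * (1 - u) = y - x" using * by (simp add: u_def field_simps)
    ultimately show ?thesis by (simp add: distrib_left mult.assoc[symmetric])
  qed
  also have "\<dots> \<le> (y - x) * h w + (x - w) * (K + h y)"
    using * assms(2) by (intro add_left_mono mult_left_mono) auto
  finally show "(y - w) * h x \<le> (y - x) * h w + (x - w) * (K + h y)" .
qed

text \<open>Used with \<open>UNIV\<close> in the last period, where s and S are real points, and
  with \<open>Zgrid M\<close> before. \<open>Hs\<close> is an inequality because on a grid the level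
  H S + K need not be attained.\<close>

locale sS_policy =
  fixes A :: "real set" and K :: real and H :: "real \<Rightarrow> real" and s S :: real
  assumes kconv: "kconvex_on A K H" and K: "0 \<le> K"
    and sA: "s \<in> A" and SA: "S \<in> A" and sS: "s \<le> S"
    and minS: "\<And>a. a \<in> A \<Longrightarrow> H S \<le> H a" and Hs: "H s \<le> H S + K"
begin

definition V :: "real \<Rightarrow> real" where "V y = (if y < s then H S + K else H y)"

text \<open>Once H i exceeds H S + K, and with it H s, a later drop by more than K would contradict
  K-convexity at s < i < j. Otherwise minimality of S settles it.\<close>

lemma H_le_K_plus:
  assumes "i \<in> A" "j \<in> A" "s \<le> i" "i \<le> j"
  shows "H i \<le> K + H j"
proof (cases "H i \<le> H S + K \<or> i = j")
  case True
  then show ?thesis using minS[OF assms(2)] K by auto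
next
  case False
  then have i: "s < i" "i < j" using assms Hs by force+
  have "(j - s) * H i \<le> (j - i) * H s + (i - s) * (K + H j)"
    using kconvex_onD[OF kconv sA assms(1,2)] i by simp
  also have "(j - i) * H s \<le> (j - i) * H i"
    using i False Hs by (intro mult_left_mono) auto
  finally have "(i - s) * H i \<le> (i - s) * (K + H j)" by (simp add: algebra_simps)
  then show ?thesis using i by simp
qed

lemma V_le_K_plus:
  assumes "i \<in> A" "j \<in> A" "i \<le> j"
  shows "V i \<le> K + V j"
  using H_le_K_plus[OF assms(1,2) _ assms(3)] minS[OF assms(2)] K assms(3) by (auto simp: V_def)

text \<open>The delicate case is w < s \<le> x with H x above H S + K. There w is moved up to s: H s
  is at most V w, and shortening x - w to x - s only helps because K + H y - H x is
  nonnegative.\<close>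

lemma V_kconvex: "kconvex_on A K V"
  unfolding kconvex_on_def
proof (intro ballI impI)
  fix w x y assume A: "w \<in> A" "x \<in> A" "y \<in> A" and *: "w < x" "x < y"
  consider "x < s" | "s \<le> w" | "w < s" "s \<le> x" by linarith
  then show "(y - w) * V x \<le> (y - x) * V w + (x - w) * (K + V y)"
  proof cases
    case 1
    then have V: "V x = H S + K" "V w = H S + K" using * by (auto simp: V_def)
    have "H S + K \<le> K + V y" using minS[OF A(3)] K by (auto simp: V_def)
    then have "(x - w) * (H S + K) \<le> (x - w) * (K + V y)" using * by (intro mult_left_mono) auto
    then show ?thesis by (simp add: V algebra_simps)
  next
    case 2
    then show ?thesis using kconvex_onD[OF kconv A *] * by (simp add: V_def)
  next
    case 3
    have V: "V x = H x" "V w = H S + K" "V y = H y" using * 3 by (auto simp: V_def)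
    have le: "H x \<le> K + H y" using H_le_K_plus[OF A(2,3)] 3 * by simp
    have "(y - x) * (H x - (H S + K)) \<le> (x - w) * (K + H y - H x)"
    proof (cases "H x \<le> H S + K")
      case True
      then have "(y - x) * (H x - (H S + K)) \<le> 0" using * by (simp add: mult_le_0_iff)
      also have "0 \<le> (x - w) * (K + H y - H x)" using * le by simp
      finally show ?thesis .
    next
      case False
      then have x: "s < x" using Hs 3 by (cases "s = x") auto
      have "(y - x) * (H x - (H S + K)) \<le> (y - x) * (H x - H s)"
        using * Hs by (intro mult_left_mono) auto
      also have "\<dots> \<le> (x - s) * (K + H y - H x)"
        using kconvex_onD[OF kconv sA A(2,3) x *(2)] by (simp add: algebra_simps)
      also have "\<dots> \<le> (x - w) * (K + H y - H x)"
        using 3 le by (intro mult_right_mono) auto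
      finally show ?thesis .
    qed
    then show ?thesis by (simp add: V algebra_simps)
  qed
qed

end

section \<open>The grid and discretised expectations\<close>

text \<open>Since demands are nonnegative, an expectation of h(y - rd d) for such h is a constant
  plus a finite sum over grid cells. Integrability and convergence of all series thus come for free;
  V, phi and omegabar are of this kind.\<close>

definition const_below :: "(real \<Rightarrow> 'a) \<Rightarrow> bool" where
  "const_below h \<longleftrightarrow> (\<exists>a c. \<forall>y<a. h y = c)"

locale grid_inventory =
  fixes M :: invmodel
  assumes hor: "hor M \<ge> 2"
    and alpha: "0 < alpha M" "alpha M \<le> 1"
    and theta: "theta M > 0"
    and Kpos: "t < hor M \<Longrightarrow> setupK M t \<ge> 0"
    and Kdec: "t + 2 \<le> hor M \<Longrightarrow> setupK M t \<ge> alpha M * setupK M (Suc t)"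
    and prob: "t < hor M \<Longrightarrow> prob_space (dem M t)"
    and borel: "t < hor M \<Longrightarrow> sets (dem M t) = sets borel"
    and nonneg: "t < hor M \<Longrightarrow> AE d in dem M t. d \<ge> 0"
    and mean: "t < hor M \<Longrightarrow> integrable (dem M t) (\<lambda>d. d)"
    and finexp: "t < hor M \<Longrightarrow> integrable (dem M t) (\<lambda>d. vopt M (Suc t) (y - d))"
    and convex: "t < hor M \<Longrightarrow> convex_on UNIV (Ccost M t)"
    and coer_top: "t < hor M \<Longrightarrow> filterlim (Ccost M t) at_top at_top"
    and coer_bot: "t < hor M \<Longrightarrow> filterlim (Ccost M t) at_top at_bot"
    and gam: "t < hor M \<Longrightarrow> gam M t \<ge> 0"
    and lip: "t < hor M \<Longrightarrow> \<bar>Ccost M t u - Ccost M t w\<bar> \<le> gam M t * \<bar>u - w\<bar>"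
begin

lemma backward_induct [consumes 1, case_names last step]:
  assumes "t < hor M" "P (hor M - 1)"
    and "\<And>t. t + 2 \<le> hor M \<Longrightarrow> P (Suc t) \<Longrightarrow> P t"
  shows "P t"
proof -
  have "t \<le> hor M - 1" using assms(1) by simp
  then show ?thesis
  proof (induction rule: inc_induct)
    case base show ?case by (rule assms(2))
  next
    case (step n)
    have "n + 2 \<le> hor M" using step.hyps by linarith
    then show ?case using step.IH by (rule assms(3))
  qed
qed

lemma zg_in [simp]: "zg M m \<in> Zgrid M"
  by (simp add: Zgrid_def)

lemma zg_diff: "zg M a - zg M b = zg M (a - b)"
  by (simp add: zg_def algebra_simps)

lemma zg_le [simp]: "zg M a \<le> zg M b \<longleftrightarrow> a \<le> b"
  using theta by (simp add: zg_def)

lemma zg_less [simp]: "zg M a < zg M b \<longleftrightarrow> a < b"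
  using theta by (simp add: zg_def)

lemma zg_1: "zg M 1 = theta M" and zg_m1: "zg M (-1) = - theta M"
  by (simp_all add: zg_def)

lemma zg_plus1: "zg M (a + 1) = zg M a + theta M"
  by (simp add: zg_def algebra_simps)

lemma ZgridE: assumes "z \<in> Zgrid M" obtains m where "z = zg M m"
  using assms by (auto simp: Zgrid_def)

lemma Zgrid_diff: "z \<in> Zgrid M \<Longrightarrow> w \<in> Zgrid M \<Longrightarrow> z - w \<in> Zgrid M"
  by (auto elim!: ZgridE simp: zg_diff)

lemma theta_Zgrid: "theta M \<in> Zgrid M"
  by (metis zg_1 zg_in)

lemma Zgrid_add_theta: "z \<in> Zgrid M \<Longrightarrow> z + theta M \<in> Zgrid M"
  by (metis ZgridE zg_plus1 zg_in)

lemma Zgrid_sub_theta: "z \<in> Zgrid M \<Longrightarrow> z - theta M \<in> Zgrid M"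
  by (intro Zgrid_diff theta_Zgrid)

lemma Zgrid_gap: "z \<in> Zgrid M \<Longrightarrow> w \<in> Zgrid M \<Longrightarrow> z < w \<Longrightarrow> z + theta M \<le> w"
  by (auto elim!: ZgridE simp flip: zg_plus1)

lemma Zgrid_floor: obtains w where "w \<in> Zgrid M" "w \<le> y" "y < w + theta M"
proof
  show "zg M \<lfloor>y / theta M\<rfloor> \<le> y"
    using theta by (simp add: zg_def flip: pos_le_divide_eq)
  have "y < zg M (\<lfloor>y / theta M\<rfloor> + 1)"
    using theta by (simp add: zg_def flip: pos_divide_less_eq)
  then show "y < zg M \<lfloor>y / theta M\<rfloor> + theta M" by (simp add: zg_plus1)
qed simp

lemma Zgrid_below: obtains w where "w \<in> Zgrid M" "w < y" "y \<le> w + theta M"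
proof -
  obtain w where "w \<in> Zgrid M" "w \<le> y" "y < w + theta M" by (rule Zgrid_floor)
  then show ?thesis
  proof (cases "w = y")
    case True
    then show ?thesis using that[of "w - theta M"] Zgrid_sub_theta[of w] \<open>w \<in> Zgrid M\<close> theta by simp
  next
    case False
    then show ?thesis using that[of w] \<open>w \<in> Zgrid M\<close> \<open>w \<le> y\<close> \<open>y < w + theta M\<close> by simp
  qed
qed

lemma Zgrid_finite: "finite {z \<in> Zgrid M. a \<le> z \<and> z \<le> b}"
proof -
  have "{z \<in> Zgrid M. a \<le> z \<and> z \<le> b} \<subseteq> zg M ` {\<lfloor>a / theta M\<rfloor>..\<lceil>b / theta M\<rceil>}"
  proof safe
    fix z assume "z \<in> Zgrid M" "a \<le> z" "z \<le> b"
    then obtain m where m: "z = zg M m" by (rule_tac ZgridE)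
    have "a / theta M \<le> m" "m \<le> b / theta M"
      using \<open>a \<le> z\<close> \<open>z \<le> b\<close> theta by (simp_all add: m zg_def pos_divide_le_eq pos_le_divide_eq)
    then have "\<lfloor>a / theta M\<rfloor> \<le> m" "m \<le> \<lceil>b / theta M\<rceil>" by linarith+
    then have "m \<in> {\<lfloor>a / theta M\<rfloor>..\<lceil>b / theta M\<rceil>}" by simp
    then show "z \<in> zg M ` {\<lfloor>a / theta M\<rfloor>..\<lceil>b / theta M\<rceil>}" using m by blast
  qed
  then show ?thesis by (rule finite_subset) simp
qed

text \<open>The maxima and minima of the construction are encoded by \<open>Sup\<close> and
  \<open>Inf\<close>. They are attained because only finitely many grid points lie between a given
  member and the bound.\<close>

lemma Zgrid_Sup_in:
  assumes "A \<subseteq> Zgrid M" "A \<noteq> {}" "\<And>z. z \<in> A \<Longrightarrow> z \<le> b"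
  shows "Sup A \<in> A" "\<And>z. z \<in> A \<Longrightarrow> z \<le> Sup A"
proof -
  have bdd: "bdd_above A" using assms(3) by (auto simp: bdd_above_def)
  show le: "z \<le> Sup A" if "z \<in> A" for z using that bdd by (rule cSup_upper)
  obtain a where a: "a \<in> A" using assms(2) by blast
  have fin: "finite {z \<in> A. a \<le> z}"
    by (rule finite_subset[OF _ Zgrid_finite[of a b]]) (use assms in auto)
  define m where "m = Max {z \<in> A. a \<le> z}"
  have m: "m \<in> {z \<in> A. a \<le> z}" unfolding m_def using fin a by (intro Max_in) auto
  have "Sup A \<le> m"
  proof (rule cSup_least[OF assms(2)])
    fix z assume "z \<in> A"
    then show "z \<le> m" using m Max_ge[OF fin, of z] by (cases "a \<le> z") (auto simp: m_def)
  qed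
  then have "Sup A = m" using le[of m] m by simp
  then show "Sup A \<in> A" using m by simp
qed

lemma Zgrid_Inf_in:
  assumes "A \<subseteq> Zgrid M" "A \<noteq> {}" "\<And>z. z \<in> A \<Longrightarrow> b \<le> z"
  shows "Inf A \<in> A"
proof -
  have bdd: "bdd_below A" using assms(3) by (auto simp: bdd_below_def)
  obtain a where a: "a \<in> A" using assms(2) by blast
  have fin: "finite {z \<in> A. z \<le> a}"
    by (rule finite_subset[OF _ Zgrid_finite[of b a]]) (use assms in auto)
  define m where "m = Min {z \<in> A. z \<le> a}"
  have m: "m \<in> {z \<in> A. z \<le> a}" unfolding m_def using fin a by (intro Min_in) auto
  have "m \<le> Inf A"
  proof (rule cInf_greatest[OF assms(2)])
    fix z assume "z \<in> A"
    then show "m \<le> z" using m Min_le[OF fin, of z] by (cases "z \<le> a") (auto simp: m_def)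
  qed
  moreover have "Inf A \<le> m" using m bdd by (intro cInf_lower) auto
  ultimately have "Inf A = m" by simp
  then show "Inf A \<in> A" using m by simp
qed

text \<open>The grid point just below a demand, so that the sums over n \<ge> -1 of the grid
  recursion become expectations over the demand; a zero demand is rounded to - theta.\<close>

definition rd :: "real \<Rightarrow> real" where
  "rd d = zg M (\<lceil>d / theta M\<rceil> - 1)"

lemma rd_Zgrid [simp]: "rd d \<in> Zgrid M"
  by (simp add: rd_def)

lemma rd_less: "rd d < d"
proof -
  have "of_int (\<lceil>d / theta M\<rceil> - 1) < d / theta M" by linarith
  then show ?thesis using theta by (simp add: rd_def zg_def field_simps)
qed

lemma rd_ge: "d - theta M \<le> rd d"
proof -
  have "d / theta M \<le> of_int \<lceil>d / theta M\<rceil>" by linarith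
  then have "d \<le> of_int \<lceil>d / theta M\<rceil> * theta M" using theta by (simp only: pos_divide_le_eq)
  then show ?thesis by (simp add: rd_def zg_def algebra_simps)
qed

lemma rd_eq_iff: "rd d = zg M m \<longleftrightarrow> zg M m < d \<and> d \<le> zg M (m + 1)"
proof -
  have "rd d = zg M m \<longleftrightarrow> \<lceil>d / theta M\<rceil> = m + 1" using theta by (auto simp: rd_def zg_def)
  also have "\<dots> \<longleftrightarrow> of_int m < d / theta M \<and> d / theta M \<le> of_int m + 1"
    by (simp add: ceiling_eq_iff)
  also have "\<dots> \<longleftrightarrow> zg M m < d \<and> d \<le> zg M (m + 1)"
    using theta by (simp add: zg_def field_simps)
  finally show ?thesis .
qed

lemma rd_ge_m1: "0 \<le> d \<Longrightarrow> - theta M \<le> rd d"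
  using rd_ge[of d] by simp

text \<open>The function h may be arbitrary: the map factors through the integer-valued ceiling,
  hence through a discrete space.\<close>

lemma rd_measurable: "(\<lambda>d. h (rd d) :: real) \<in> borel_measurable borel"
proof -
  have "(\<lambda>d::real. \<lceil>d / theta M\<rceil>) \<in> borel \<rightarrow>\<^sub>M count_space UNIV" by measurable
  from measurable_compose[OF this, of "\<lambda>k. h (zg M (k - 1))" borel]
  show ?thesis by (simp add: rd_def)
qed

lemma fprob_eq:
  assumes "t < hor M"
  shows "fprob M t m = measure (dem M t) {d. rd d = zg M m}"
proof -
  interpret prob_space "dem M t" by (rule prob[OF assms])
  have [simp]: "space (dem M t) = UNIV" "sets (dem M t) = sets borel"
    using borel[OF assms] sets_eq_imp_space_eq[OF borel[OF assms]] by auto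
  have "{d. rd d = zg M m} = {..zg M (m + 1)} - {..zg M m}"
    by (auto simp: rd_eq_iff)
  then show ?thesis
    by (simp add: fprob_def) (subst finite_measure_Diff, auto)
qed

definition Ed :: "nat \<Rightarrow> (real \<Rightarrow> real) \<Rightarrow> real \<Rightarrow> real" where
  "Ed t h y = (\<integral>d. h (y - rd d) \<partial>dem M t)"

lemma Ed_integrable_sum:
  assumes t: "t < hor M" and h: "const_below h"
  shows "integrable (dem M t) (\<lambda>d. h (y - rd d))"
    and "sum_from_m1 (\<lambda>m. h (y - zg M m) * fprob M t m) = Ed t h y"
proof -
  interpret prob_space "dem M t" by (rule prob[OF t])
  have [simp]: "space (dem M t) = UNIV" "sets (dem M t) = sets borel"
    using borel[OF t] sets_eq_imp_space_eq[OF borel[OF t]] by auto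
  have [measurable_cong]: "sets (dem M t) = sets borel" by simp
  obtain a c where c: "\<And>y. y < a \<Longrightarrow> h y = c" using h unfolding const_below_def by blast
  \<comment> \<open>From index N on the level lies below a; adding 3 covers the index shift and
    strictness with room to spare.\<close>
  define N where "N = nat (\<lceil>(y - a) / theta M\<rceil> + 3)"
  have N: "h (y - zg M (int j - 1)) = c" if "j \<ge> N" for j
  proof (rule c)
    have "(y - a) / theta M < int j - 1" using that unfolding N_def by linarith
    then show "y - zg M (int j - 1) < a" using theta by (simp add: zg_def field_simps)
  qed
  \<comment> \<open>\<open>E 0\<close> is the cell \<open>{- theta M<..0}\<close>, which catches a
    zero demand.\<close>
  define E where "E j = {d. rd d = zg M (int j - 1)}" for j
  have E: "E j \<in> events" for j
  proof -
    have "E j = {zg M (int j - 1)<..zg M (int j)}" by (auto simp: E_def rd_eq_iff)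
    then show ?thesis by simp
  qed
  have f: "fprob M t (int j - 1) = prob (E j)" for j by (simp add: fprob_eq[OF t] E_def)
  define g where "g j = h (y - zg M (int j - 1))" for j
  have key: "h (y - rd d) = c + (\<Sum>j<N. (g j - c) * indicat_real (E j) d)" if "0 \<le> d" for d
  proof -
    define i where "i = nat \<lceil>d / theta M\<rceil>"
    have "0 \<le> d / theta M" using that theta by simp
    then have "0 \<le> \<lceil>d / theta M\<rceil>" by linarith
    then have i: "rd d = zg M (int i - 1)" by (simp add: rd_def i_def)
    have ind: "indicat_real (E j) d = (if j = i then 1 else 0)" for j
      using theta by (auto simp: E_def i indicator_def zg_def)
    have "(\<Sum>j<N. (g j - c) * indicat_real (E j) d) = (if i < N then g i - c else 0)"
      by (simp add: ind if_distrib cong: if_cong)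
    then show ?thesis using N[of i] by (auto simp: i g_def)
  qed
  have int_ind: "integrable (dem M t) (\<lambda>d. (g j - c) * indicat_real (E j) d)" for j
    using E[of j] by (intro integrable_mult_right integrable_real_indicator) (auto simp: emeasure_eq_measure)
  have int_sum: "integrable (dem M t) (\<lambda>d. \<Sum>j<N. (g j - c) * indicat_real (E j) d)"
    by (intro Bochner_Integration.integrable_sum int_ind)
  have int_all: "integrable (dem M t) (\<lambda>d. c + (\<Sum>j<N. (g j - c) * indicat_real (E j) d))"
    using int_sum by (intro Bochner_Integration.integrable_add) auto
  have "(\<integral>d. (\<Sum>j<N. (g j - c) * indicat_real (E j) d) \<partial>dem M t) = (\<Sum>j<N. (g j - c) * prob (E j))"
    by (subst Bochner_Integration.integral_sum[OF int_ind]) (simp add: E)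
  then have val: "(\<integral>d. c + (\<Sum>j<N. (g j - c) * indicat_real (E j) d) \<partial>dem M t)
      = c + (\<Sum>j<N. (g j - c) * prob (E j))"
    using prob_space by (subst Bochner_Integration.integral_add[OF _ int_sum]) simp_all
  have AE: "AE d in dem M t. c + (\<Sum>j<N. (g j - c) * indicat_real (E j) d) = h (y - rd d)"
    using nonneg[OF t] by (rule AE_mp) (auto simp: key)
  have meas: "(\<lambda>d. h (y - rd d)) \<in> borel_measurable (dem M t)"
    using rd_measurable[of "\<lambda>u. h (y - u)"] by (simp cong: measurable_cong_sets)
  show "integrable (dem M t) (\<lambda>d. h (y - rd d))"
    using integrable_cong_AE[THEN iffD1, OF borel_measurable_integrable[OF int_all] meas AE int_all] .
  have hb: "Ed t h y = c + (\<Sum>j<N. (g j - c) * prob (E j))"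
    using integral_cong_AE[OF borel_measurable_integrable[OF int_all] meas AE] val by (simp add: Ed_def)
  \<comment> \<open>The cells exhaust the nonnegative reals, so their probabilities sum to 1; this
    accounts for the constant c in the infinite series.\<close>
  have UN: "AE d in dem M t. d \<in> (\<Union>j. E j)"
    using nonneg[OF t]
  proof (rule AE_mp, intro AE_I2 impI)
    fix d :: real assume "0 \<le> d"
    then have "0 \<le> d / theta M" using theta by simp
    then have "0 \<le> \<lceil>d / theta M\<rceil>" by linarith
    then have "rd d = zg M (int (nat \<lceil>d / theta M\<rceil>) - 1)" by (simp add: rd_def)
    then show "d \<in> (\<Union>j. E j)" unfolding E_def by blast
  qed
  have "disjoint_family E"
    using theta by (auto simp: disjoint_family_on_def E_def zg_def)
  then have "(\<lambda>j. prob (E j)) sums prob (\<Union>j. E j)"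
    using E by (intro finite_measure_UNION) auto
  also have "prob (\<Union>j. E j) = 1" using UN E by (intro prob_eq_1[THEN iffD2]) auto
  finally have "(\<lambda>j. c * prob (E j)) sums (c * 1)" by (rule sums_mult)
  moreover have "(\<lambda>j. (g j - c) * prob (E j)) sums (\<Sum>j<N. (g j - c) * prob (E j))"
    using N by (intro sums_finite) (auto simp: g_def)
  ultimately have "(\<lambda>j. c * prob (E j) + (g j - c) * prob (E j)) sums
      (c * 1 + (\<Sum>j<N. (g j - c) * prob (E j)))" by (rule sums_add)
  then have "(\<lambda>j. g j * prob (E j)) sums (c + (\<Sum>j<N. (g j - c) * prob (E j)))"
    by (simp add: algebra_simps)
  then show "sum_from_m1 (\<lambda>m. h (y - zg M m) * fprob M t m) = Ed t h y"
    by (simp add: sum_from_m1_def f g_def[symmetric] sums_iff hb)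
qed

section \<open>Levels of the approximating policy\<close>

lemma Ccost_between:
  assumes "t < hor M" "w \<le> x" "x \<le> y"
  shows "Ccost M t w \<le> Ccost M t y \<Longrightarrow> Ccost M t x \<le> Ccost M t y"
    and "Ccost M t y \<le> Ccost M t w \<Longrightarrow> Ccost M t x \<le> Ccost M t w"
proof -
  let ?C = "Ccost M t"
  have "?C x \<le> max (?C w) (?C y)"
  proof (cases "w < x \<and> x < y")
    case True
    have "(y - w) * ?C x \<le> (y - x) * ?C w + (x - w) * ?C y"
      using kconvex_onD[OF convex_on_imp_kconvex_on[OF convex[OF assms(1)] order_refl], of w UNIV x y] True
      by simp
    also have "\<dots> \<le> (y - x) * max (?C w) (?C y) + (x - w) * max (?C w) (?C y)"
      using assms by (intro add_mono mult_left_mono) auto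
    finally have "(y - w) * ?C x \<le> (y - w) * max (?C w) (?C y)" by (simp add: algebra_simps)
    then show ?thesis using True by simp
  next
    case False
    then have "x = w \<or> x = y" using assms by auto
    then show ?thesis by auto
  qed
  then show "?C w \<le> ?C y \<Longrightarrow> ?C x \<le> ?C y" "?C y \<le> ?C w \<Longrightarrow> ?C x \<le> ?C w" by auto
qed

lemma Ccost_gt_left: "t < hor M \<Longrightarrow> \<exists>a. \<forall>y\<le>a. c < Ccost M t y"
  using coer_bot[of t] by (simp add: filterlim_at_top_dense eventually_at_bot_linorder)

lemma Ccost_gt_right: "t < hor M \<Longrightarrow> \<exists>b. \<forall>y\<ge>b. c < Ccost M t y"
  using coer_top[of t] by (simp add: filterlim_at_top_dense eventually_at_top_linorder)

lemma Ccost_continuous: "t < hor M \<Longrightarrow> continuous_on UNIV (Ccost M t)"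
  using convex by (intro convex_on_continuous) auto

text \<open>\<open>Cmin\<close> is the infimum of the set of minimizers. Coercivity makes this set
  nonempty and bounded below and continuity makes it closed, so the infimum is itself a
  minimizer.\<close>

lemma Cmin_le:
  assumes t: "t < hor M"
  shows "Ccost M t (Cmin M t) \<le> Ccost M t x"
proof -
  let ?C = "Ccost M t"
  obtain a where a: "\<And>y. y \<le> a \<Longrightarrow> ?C 0 < ?C y" using Ccost_gt_left[OF t] by blast
  obtain b where b: "\<And>y. b \<le> y \<Longrightarrow> ?C 0 < ?C y" using Ccost_gt_right[OF t] by blast
  have ab: "a < 0" "0 < b" using a[of 0] b[of 0] by force+
  have "\<exists>m\<in>{a..b}. \<forall>y\<in>{a..b}. ?C m \<le> ?C y"
    using continuous_on_subset[OF Ccost_continuous[OF t]] ab by (intro continuous_attains_inf) auto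
  then obtain m where "\<forall>y\<in>{a..b}. ?C m \<le> ?C y" by blast
  then have m: "\<And>y. a \<le> y \<Longrightarrow> y \<le> b \<Longrightarrow> ?C m \<le> ?C y" by simp
  have m': "?C m \<le> ?C y" for y
    using a[of y] b[of y] m[of 0] m[of y] ab by (cases "y < a"; cases "b < y") auto
  define A where "A = {y. \<forall>x. ?C y \<le> ?C x}"
  have A_eq: "A = {y. ?C y \<le> ?C m}" using m' order_trans by (auto simp: A_def)
  have "closed A" unfolding A_eq
    using Ccost_continuous[OF t] by (intro closed_Collect_le) auto
  moreover have "bdd_below A"
  proof (rule bdd_belowI[of _ a])
    fix y assume "y \<in> A"
    then have "?C y \<le> ?C 0" by (simp add: A_def)
    then show "a \<le> y" using a[of y] by force
  qed
  moreover have "m \<in> A" using m' by (simp add: A_def)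
  ultimately have "Inf A \<in> A" by (intro closed_contains_Inf) auto
  then show ?thesis by (simp add: A_def Cmin_def)
qed

lemma Ccost_mono: "t < hor M \<Longrightarrow> Cmin M t \<le> x \<Longrightarrow> x \<le> y \<Longrightarrow> Ccost M t x \<le> Ccost M t y"
  using Ccost_between(1) Cmin_le by blast

lemma Ccost_anti: "t < hor M \<Longrightarrow> x \<le> y \<Longrightarrow> y \<le> Cmin M t \<Longrightarrow> Ccost M t y \<le> Ccost M t x"
  using Ccost_between(2) Cmin_le by blast

lemma zn0_props: "zn0 M t \<in> Zgrid M" "zn0 M t < Cmin M t" "Cmin M t \<le> zn0 M t + theta M"
proof -
  have "zn0 M t \<in> Zgrid M \<and> zn0 M t < Cmin M t \<and> Cmin M t \<le> zn0 M t + theta M"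
    unfolding zn0_def
  proof (rule theI')
    obtain w where w: "w \<in> Zgrid M" "w < Cmin M t" "Cmin M t \<le> w + theta M"
      by (rule Zgrid_below)
    show "\<exists>!z. z \<in> Zgrid M \<and> z < Cmin M t \<and> Cmin M t \<le> z + theta M"
    proof (rule ex1I)
      show "w \<in> Zgrid M \<and> w < Cmin M t \<and> Cmin M t \<le> w + theta M" using w by simp
      fix z assume z: "z \<in> Zgrid M \<and> z < Cmin M t \<and> Cmin M t \<le> z + theta M"
      then show "z = w"
        using w Zgrid_gap[of z w] Zgrid_gap[of w z] by (cases z w rule: linorder_cases) auto
    qed
  qed
  then show "zn0 M t \<in> Zgrid M" "zn0 M t < Cmin M t" "Cmin M t \<le> zn0 M t + theta M" by auto
qed

lemma SU_props:
  assumes t: "t < hor M"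
  shows "SU M t \<in> Zgrid M" "Cmin M t \<le> SU M t"
    "Ccost M t (zn0 M t) + setupK M t < Ccost M t (SU M t)"
proof -
  let ?A = "{z \<in> Zgrid M. z \<ge> Cmin M t \<and> Ccost M t z > Ccost M t (zn0 M t) + setupK M t}"
  obtain b where b: "\<And>y. b \<le> y \<Longrightarrow> Ccost M t (zn0 M t) + setupK M t < Ccost M t y"
    using Ccost_gt_right[OF t] by blast
  obtain w where w: "w \<in> Zgrid M" "max b (Cmin M t) < w + theta M" by (metis Zgrid_floor)
  then have "w + theta M \<in> ?A" using b Zgrid_add_theta by auto
  then have "Inf ?A \<in> ?A" by (intro Zgrid_Inf_in[where b = "Cmin M t"]) auto
  then show "SU M t \<in> Zgrid M" "Cmin M t \<le> SU M t"
    "Ccost M t (zn0 M t) + setupK M t < Ccost M t (SU M t)" by (auto simp: SU_def)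
qed

lemma Ccost_above_SU:
  "t < hor M \<Longrightarrow> SU M t \<le> y \<Longrightarrow> Ccost M t (zn0 M t) + setupK M t < Ccost M t y"
  using SU_props(3)[of t] Ccost_mono[OF _ SU_props(2), of t y] by fastforce

lemma zn0_less_SU: "t < hor M \<Longrightarrow> zn0 M t < SU M t"
  using zn0_props(2)[of t] SU_props(2)[of t] by linarith

text \<open>The choice in \<open>sT1\<close> has a witness by the intermediate value theorem,
  between a far left point where C exceeds the level and the minimizer.\<close>

lemma sT1_props:
  "sT1 M \<le> Cmin M (hor M - 1)"
  "Ccost M (hor M - 1) (sT1 M) = Ccost M (hor M - 1) (Cmin M (hor M - 1)) + setupK M (hor M - 1)"
proof -
  let ?t = "hor M - 1"
  let ?C = "Ccost M ?t"
  have t: "?t < hor M" using hor by simp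
  let ?c = "?C (Cmin M ?t) + setupK M ?t"
  obtain a where a: "\<And>y. y \<le> a \<Longrightarrow> ?c < ?C y" using Ccost_gt_left[OF t] by blast
  have "a < Cmin M ?t" using a[of "Cmin M ?t"] Kpos[OF t] by force
  then have "\<exists>x\<ge>a. x \<le> Cmin M ?t \<and> ?C x = ?c"
    using a[of a] Kpos[OF t] continuous_on_subset[OF Ccost_continuous[OF t]] by (intro IVT2') auto
  then have "\<exists>s. s \<le> Cmin M ?t \<and> ?C s = ?c" by blast
  then have "sT1 M \<le> Cmin M ?t \<and> ?C (sT1 M) = ?c" unfolding sT1_def by (rule someI_ex)
  then show "sT1 M \<le> Cmin M ?t" "?C (sT1 M) = ?c" by auto
qed

lemma Ilow_props:
  "Ilow M t \<in> Zgrid M" "Ilow M t < Ibar M (Suc t) - theta M" "Ilow M t < Cmin M t"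
proof -
  let ?A = "{z \<in> Zgrid M. z < min (Ibar M (Suc t) - theta M) (Cmin M t)}"
  obtain w where "w \<in> Zgrid M" "w < min (Ibar M (Suc t) - theta M) (Cmin M t)" by (metis Zgrid_below)
  then have "w \<in> ?A" by auto
  then have "Sup ?A \<in> ?A"
    by (intro Zgrid_Sup_in(1)[where b = "Cmin M t"]) auto
  then show "Ilow M t \<in> Zgrid M" "Ilow M t < Ibar M (Suc t) - theta M" "Ilow M t < Cmin M t"
    by (auto simp: Ilow_def Ilow_of_def)
qed

lemma Ibar_rec:
  assumes "t + 2 \<le> hor M"
  shows "Ibar M t = Sup {z \<in> Zgrid M. z \<le> Ilow M t \<and> Ccost M t z > Ccost M t (Ilow M t) + setupK M t} + theta M"
proof -
  define n where "n = hor M - 2 - t"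
  have n: "hor M - Suc t = Suc n" "hor M - Suc (Suc t) = n" "hor M - Suc (Suc n) = t"
    using assms by (auto simp: n_def)
  show ?thesis by (simp add: Ibar_def Ilow_def n Let_def)
qed

text \<open>\<open>Ibar M t - theta M\<close> is the attained maximum of the set in the definition;
  as C_t is nonincreasing left of its minimizer, the excess found there persists at every real point
  further left.\<close>

lemma Ibar_props:
  assumes t: "t + 2 \<le> hor M"
  shows "Ibar M t \<in> Zgrid M" "Ibar M t \<le> Ilow M t"
    "y \<le> Ibar M t - theta M \<Longrightarrow> Ccost M t (Ilow M t) + setupK M t < Ccost M t y"
proof -
  have t': "t < hor M" using t by simp
  let ?A = "{z \<in> Zgrid M. z \<le> Ilow M t \<and> Ccost M t z > Ccost M t (Ilow M t) + setupK M t}"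
  obtain a where a: "\<And>y. y \<le> a \<Longrightarrow> Ccost M t (Ilow M t) + setupK M t < Ccost M t y"
    using Ccost_gt_left[OF t'] by blast
  obtain w where "w \<in> Zgrid M" "w < min a (Ilow M t)" by (metis Zgrid_below)
  then have "w \<in> ?A" using a by auto
  then have "Sup ?A \<in> ?A" by (intro Zgrid_Sup_in(1)[where b = "Ilow M t"]) auto
  moreover have I: "Ibar M t - theta M = Sup ?A" using Ibar_rec[OF t] by simp
  ultimately have *: "Ibar M t - theta M \<in> ?A" by simp
  then show "Ibar M t \<in> Zgrid M" using Zgrid_add_theta[of "Ibar M t - theta M"] by simp
  have "Ibar M t - theta M \<noteq> Ilow M t" using * Kpos[OF t'] by auto
  then have "Ibar M t - theta M < Ilow M t" using * by simp
  then show "Ibar M t \<le> Ilow M t"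
    using Zgrid_gap[of "Ibar M t - theta M" "Ilow M t"] * Ilow_props(1) by simp
  assume "y \<le> Ibar M t - theta M"
  then show "Ccost M t (Ilow M t) + setupK M t < Ccost M t y"
    using Ccost_anti[OF t', of y "Ibar M t - theta M"] Ilow_props(3)[of t] * by auto
qed

lemma H_last: "Hf M (hor M - 1) = Ccost M (hor M - 1)"
  and S_last: "Sf M (hor M - 1) = Cmin M (hor M - 1)"
  and s_last: "sf M (hor M - 1) = sT1 M"
  by (simp_all add: Hf_def Sf_def sf_def)

lemma Ibar_last: "Ibar M (hor M - 1) = sT1 M"
  by (simp add: Ibar_def)

lemma const_below_V: "const_below (Vf M t)"
  unfolding const_below_def Vf_def by (rule exI[of _ "sf M t"]) auto

definition grid_candidates :: "nat \<Rightarrow> real set" where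
  "grid_candidates t = {z \<in> Zgrid M. Ilow M t \<le> z \<and> z \<le> SU M t}"

lemma policy_rec:
  assumes t: "t + 2 \<le> hor M"
  shows "Hf M t = (\<lambda>y. Ccost M t y + alpha M * Ed t (Vf M (Suc t)) y)" (is ?H)
    and "Sf M t = Max {z \<in> grid_candidates t. \<forall>w\<in>grid_candidates t. Hf M t z \<le> Hf M t w}" (is ?S)
    and "sf M t = (if setupK M t = 0 then Sf M t else
      Min {z \<in> Zgrid M. Ibar M t \<le> z \<and> z \<le> Sf M t \<and> Hf M t z \<le> Hf M t (Sf M t) + setupK M t})" (is ?s)
proof -
  define n where "n = hor M - 2 - t"
  have n: "hor M - Suc t = Suc n" "hor M - Suc (Suc t) = n" "hor M - Suc (Suc n) = t"
    "hor M - 1 - t = Suc n"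
    using t by (auto simp: n_def)
  obtain H' S' s' where HS: "HSaux M n = (H', S', s')" by (metis prod_cases3)
  have V': "Vf M (Suc t) = (\<lambda>y. if y < s' then H' S' + setupK M (Suc t) else H' y)"
    by (auto simp: Vf_def Hf_def Sf_def sf_def n HS)
  have t': "t < hor M" using t by simp
  show ?H
    unfolding Ed_integrable_sum(2)[OF t' const_below_V, symmetric]
    unfolding V' by (simp add: Hf_def n HS Let_def)
  show ?S by (simp add: Hf_def Sf_def n HS Let_def grid_candidates_def)
  show ?s
    unfolding Hf_def Sf_def sf_def n HSaux.simps HS Let_def prod.case fst_conv snd_conv ..
qed

lemmas H_rec = policy_rec(1)[THEN fun_cong]

lemma S_props:
  assumes t: "t + 2 \<le> hor M"
  shows "Sf M t \<in> Zgrid M" "Ilow M t \<le> Sf M t" "Sf M t \<le> SU M t"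
    "w \<in> Zgrid M \<Longrightarrow> Ilow M t \<le> w \<Longrightarrow> w \<le> SU M t \<Longrightarrow> Hf M t (Sf M t) \<le> Hf M t w"
proof -
  let ?G = "grid_candidates t"
  let ?A = "{z \<in> ?G. \<forall>w\<in>?G. Hf M t z \<le> Hf M t w}"
  have fin: "finite ?G" unfolding grid_candidates_def by (rule Zgrid_finite)
  have "Ilow M t \<le> SU M t" using Ilow_props(3)[of t] SU_props(2)[of t] t by simp
  then have ne: "?G \<noteq> {}" using Ilow_props(1)[of t] by (auto simp: grid_candidates_def)
  obtain z where "z \<in> ?G" "\<And>w. w \<in> ?G \<Longrightarrow> Hf M t z \<le> Hf M t w"
    using ex_min_if_finite[of "Hf M t ` ?G"] fin ne
    by (metis (mono_tags, lifting) arg_min_if_finite(1) arg_min_least)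
  then have "Max ?A \<in> ?A" using fin by (intro Max_in) auto
  then have "Sf M t \<in> ?A" by (simp add: policy_rec(2)[OF t])
  then show "Sf M t \<in> Zgrid M" "Ilow M t \<le> Sf M t" "Sf M t \<le> SU M t"
    "w \<in> Zgrid M \<Longrightarrow> Ilow M t \<le> w \<Longrightarrow> w \<le> SU M t \<Longrightarrow> Hf M t (Sf M t) \<le> Hf M t w"
    by (auto simp: grid_candidates_def)
qed

lemma s_props:
  assumes t: "t + 2 \<le> hor M"
  shows "sf M t \<in> Zgrid M" "Ibar M t \<le> sf M t" "sf M t \<le> Sf M t"
    "Hf M t (sf M t) \<le> Hf M t (Sf M t) + setupK M t"
    "w \<in> Zgrid M \<Longrightarrow> Ibar M t \<le> w \<Longrightarrow> w < sf M t \<Longrightarrow> setupK M t \<noteq> 0 \<Longrightarrow>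
      Hf M t (Sf M t) + setupK M t < Hf M t w"
proof -
  have t': "t < hor M" using t by simp
  have I: "Ibar M t \<le> Sf M t" using Ibar_props(2)[OF t] S_props(2)[OF t] by simp
  let ?A = "{z \<in> Zgrid M. Ibar M t \<le> z \<and> z \<le> Sf M t \<and> Hf M t z \<le> Hf M t (Sf M t) + setupK M t}"
  have fin: "finite ?A" by (rule finite_subset[OF _ Zgrid_finite[of "Ibar M t" "Sf M t"]]) auto
  have S: "Sf M t \<in> ?A" using I S_props(1)[OF t] Kpos[OF t'] by auto
  have "Min ?A \<in> ?A" using S by (intro Min_in[OF fin]) blast
  then have "sf M t \<in> ?A" using S unfolding policy_rec(3)[OF t] by (cases "setupK M t = 0") simp_all
  then show "sf M t \<in> Zgrid M" "Ibar M t \<le> sf M t" and sS: "sf M t \<le> Sf M t"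
    and "Hf M t (sf M t) \<le> Hf M t (Sf M t) + setupK M t" by auto
  assume w: "w \<in> Zgrid M" "Ibar M t \<le> w" "w < sf M t" "setupK M t \<noteq> 0"
  then have "w < Min ?A" by (simp add: policy_rec(3)[OF t])
  then have "w \<notin> ?A" using Min_le[OF fin, of w] by linarith
  then show "Hf M t (Sf M t) + setupK M t < Hf M t w" using w sS by auto
qed

lemma Ibar_le_s: "t < hor M \<Longrightarrow> Ibar M t \<le> sf M t"
proof (induction rule: backward_induct)
  case last
  show ?case by (simp only: s_last Ibar_last)
next
  case (step t)
  then show ?case by (intro s_props(2))
qed

text \<open>A rounded demand is at least - theta, so the next level is at most y + theta. The margin
  theta in the definition of I_t keeps this below \<bar>I_{t+1} \<le> s_{t+1}, where V_{t+1} is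
  constant.\<close>

lemma H_below_Ilow:
  assumes t: "t + 2 \<le> hor M" and y: "y \<le> Ilow M t"
  shows "Hf M t y = Ccost M t y + alpha M * (Hf M (Suc t) (Sf M (Suc t)) + setupK M (Suc t))"
proof -
  have t': "t < hor M" "Suc t < hor M" using t by auto
  interpret prob_space "dem M t" by (rule prob[OF t'(1)])
  let ?c = "Hf M (Suc t) (Sf M (Suc t)) + setupK M (Suc t)"
  have "AE d in dem M t. Vf M (Suc t) (y - rd d) = ?c"
  proof (rule AE_mp[OF nonneg[OF t'(1)]], intro AE_I2 impI)
    fix d :: real assume "0 \<le> d"
    then have "y - rd d < sf M (Suc t)"
      using rd_ge_m1[of d] y Ilow_props(2)[of t] Ibar_le_s[OF t'(2)] by linarith
    then show "Vf M (Suc t) (y - rd d) = ?c" by (simp add: Vf_def)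
  qed
  then have "Ed t (Vf M (Suc t)) y = (\<integral>d. ?c \<partial>dem M t)"
    unfolding Ed_def
    using borel_measurable_integrable[OF Ed_integrable_sum(1)[OF t'(1) const_below_V]]
    by (intro integral_cong_AE) auto
  then show ?thesis using prob_space by (simp add: H_rec[OF t])
qed

text \<open>Ordering pays at every grid point below s. Left of \<open>Ibar\<close> this is read off
  C, from which H differs by a constant there; from \<open>Ibar\<close> on it is the minimality of
  s, or that of S when K = 0 and s = S.\<close>

lemma H_ge_below_s:
  assumes t: "t + 2 \<le> hor M" and w: "w \<in> Zgrid M" "w < sf M t"
  shows "Hf M t (Sf M t) + setupK M t \<le> Hf M t w"
proof -
  have t': "t < hor M" using t by simp
  have SI: "Hf M t (Sf M t) \<le> Hf M t (Ilow M t)"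
    using S_props[OF t] Ilow_props(1)[of t] by (intro S_props(4)[OF t]) auto
  consider "w < Ibar M t" | "Ibar M t \<le> w" "setupK M t \<noteq> 0" | "Ibar M t \<le> w" "setupK M t = 0"
    by linarith
  then show ?thesis
  proof cases
    case 1
    then have "w \<le> Ibar M t - theta M" using Zgrid_gap[OF w(1) Ibar_props(1)[OF t]] by simp
    then have "Ccost M t (Ilow M t) + setupK M t < Ccost M t w" by (rule Ibar_props(3)[OF t])
    moreover have "w \<le> Ilow M t" using 1 Ibar_props(2)[OF t] by simp
    ultimately show ?thesis using SI H_below_Ilow[OF t, of w] H_below_Ilow[OF t, of "Ilow M t"] by simp
  next
    case 2
    then show ?thesis using s_props(5)[OF t w(1) _ w(2)] by simp
  next
    case 3
    have "Hf M t (Sf M t) \<le> Hf M t w"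
    proof (cases "w < Ilow M t")
      case True
      then have "Ccost M t (Ilow M t) \<le> Ccost M t w"
        using Ilow_props(3)[of t] by (intro Ccost_anti[OF t']) auto
      then show ?thesis using SI H_below_Ilow[OF t, of w] H_below_Ilow[OF t, of "Ilow M t"] True by simp
    next
      case False
      then show ?thesis using w S_props(3)[OF t] s_props(3)[OF t] by (intro S_props(4)[OF t]) auto
    qed
    then show ?thesis using 3 by simp
  qed
qed

section \<open>Optimality of (s_t, S_t) among grid points\<close>

lemma Ed_leI:
  assumes t: "t < hor M" and h: "const_below h" "const_below h'"
    and le: "\<And>d. 0 \<le> d \<Longrightarrow> h (y - rd d) \<le> c + h' (y' - rd d)"
  shows "Ed t h y \<le> c + Ed t h' y'"
proof -
  interpret prob_space "dem M t" by (rule prob[OF t])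
  have i: "integrable (dem M t) (\<lambda>d. h (y - rd d))" "integrable (dem M t) (\<lambda>d. h' (y' - rd d))"
    by (auto intro: Ed_integrable_sum(1)[OF t] h)
  have "AE d in dem M t. h (y - rd d) \<le> c + h' (y' - rd d)"
    using nonneg[OF t] by (rule AE_mp) (auto intro: le)
  then have "Ed t h y \<le> (\<integral>d. c + h' (y' - rd d) \<partial>dem M t)"
    unfolding Ed_def using i by (intro integral_mono_AE) auto
  also have "\<dots> = c + Ed t h' y'"
    using i prob_space by (simp add: Ed_def)
  finally show ?thesis .
qed

lemma V_eq_policy_V: "Vf M t = sS_policy.V (setupK M t) (Hf M t) (sf M t) (Sf M t)"
  if "sS_policy A (setupK M t) (Hf M t) (sf M t) (Sf M t)"
  using sS_policy.V_def[OF that] by (auto simp: Vf_def)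

text \<open>The induction invariant: K-convexity feeds Scarf's argument in the preceding period, and
  the second part rules out minimizers beyond SU there.\<close>

definition V_grid_regular :: "nat \<Rightarrow> bool" where
  "V_grid_regular t \<longleftrightarrow> kconvex_on (Zgrid M) (setupK M t) (Vf M t) \<and>
     (\<forall>i\<in>Zgrid M. \<forall>j\<in>Zgrid M. i \<le> j \<longrightarrow> Vf M t i \<le> setupK M t + Vf M t j)"

lemma last_policy: "sS_policy UNIV (setupK M (hor M - 1)) (Hf M (hor M - 1)) (sf M (hor M - 1)) (Sf M (hor M - 1))"
proof -
  have t: "hor M - 1 < hor M" using hor by simp
  show ?thesis
    unfolding H_last S_last s_last
    using convex_on_imp_kconvex_on[OF convex[OF t] Kpos[OF t]] Kpos[OF t] Cmin_le[OF t] sT1_props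
    by unfold_locales auto
qed

lemma V_grid_regular_last: "V_grid_regular (hor M - 1)"
  using sS_policy.V_kconvex[OF last_policy] sS_policy.V_le_K_plus[OF last_policy]
  unfolding V_grid_regular_def V_eq_policy_V[OF last_policy]
  by (auto intro: kconvex_on_subset)

text \<open>For grid points y all y - rd d are grid points, so the expectation inherits K-convexity
  on the grid. It remains to extend minimality of S from the candidates in [I_t, SU_t] to the whole
  grid.\<close>

lemma policy_step:
  assumes t: "t + 2 \<le> hor M" and V: "V_grid_regular (Suc t)"
  shows "sS_policy (Zgrid M) (setupK M t) (Hf M t) (sf M t) (Sf M t)"
proof
  have t': "t < hor M" "Suc t < hor M" using t by auto
  interpret prob_space "dem M t" by (rule prob[OF t'(1)])
  let ?V = "Vf M (Suc t)" and ?K = "setupK M (Suc t)"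
  have Vk: "kconvex_on (Zgrid M) ?K ?V"
    and Vle: "\<And>i j. i \<in> Zgrid M \<Longrightarrow> j \<in> Zgrid M \<Longrightarrow> i \<le> j \<Longrightarrow> ?V i \<le> ?K + ?V j"
    using V by (auto simp: V_grid_regular_def)
  note i = Ed_integrable_sum(1)[OF t'(1) const_below_V, of "Suc t"]
  show "kconvex_on (Zgrid M) (setupK M t) (Hf M t)"
    unfolding kconvex_on_def
  proof (intro ballI impI)
    fix w x y assume A: "w \<in> Zgrid M" "x \<in> Zgrid M" "y \<in> Zgrid M" and *: "w < x" "x < y"
    have "(y - w) * Ed t ?V x = (\<integral>d. (y - w) * ?V (x - rd d) \<partial>dem M t)"
      by (simp add: Ed_def)
    also have "\<dots> \<le> (\<integral>d. (y - x) * ?V (w - rd d) + (x - w) * (?K + ?V (y - rd d)) \<partial>dem M t)"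
    proof (rule integral_mono)
      fix d
      show "(y - w) * ?V (x - rd d) \<le> (y - x) * ?V (w - rd d) + (x - w) * (?K + ?V (y - rd d))"
        using kconvex_onD[OF Vk, of "w - rd d" "x - rd d" "y - rd d"] A * Zgrid_diff rd_Zgrid by simp
    qed (use i in auto)
    also have "\<dots> = (y - x) * Ed t ?V w + (x - w) * (?K + Ed t ?V y)"
      using i prob_space by (simp add: Ed_def)
    finally have "alpha M * ((y - w) * Ed t ?V x) \<le> alpha M * ((y - x) * Ed t ?V w + (x - w) * (?K + Ed t ?V y))"
      using alpha by (intro mult_left_mono) auto
    \<comment> \<open>The K-convexity constant of the discounted future cost is alpha K_{t+1}, which
      the standing assumption bounds by K_t.\<close>
    moreover have "(x - w) * (alpha M * ?K) \<le> (x - w) * setupK M t"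
      using * Kdec[OF t] by (intro mult_left_mono) auto
    moreover have "(y - w) * Ccost M t x \<le> (y - x) * Ccost M t w + (x - w) * (0 + Ccost M t y)"
      using kconvex_onD[OF convex_on_imp_kconvex_on[OF convex[OF t'(1)] order_refl], of w UNIV x y] * by simp
    ultimately show "(y - w) * Hf M t x \<le> (y - x) * Hf M t w + (x - w) * (setupK M t + Hf M t y)"
      unfolding H_rec[OF t] by (simp add: algebra_simps)
  qed
  show "0 \<le> setupK M t" by (rule Kpos[OF t'(1)])
  show "sf M t \<in> Zgrid M" "Sf M t \<in> Zgrid M" "sf M t \<le> Sf M t"
    "Hf M t (sf M t) \<le> Hf M t (Sf M t) + setupK M t"
    using s_props[OF t] S_props[OF t] by auto
  fix z assume z: "z \<in> Zgrid M"
  consider "z < sf M t" | "sf M t \<le> z" "z < Ilow M t" | "Ilow M t \<le> z" "z \<le> SU M t" | "SU M t < z" by linarith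
  then show "Hf M t (Sf M t) \<le> Hf M t z"
  proof cases
    case 1
    then show ?thesis using H_ge_below_s[OF t z] Kpos[OF t'(1)] by simp
  next
    case 2
    have "Hf M t (Sf M t) \<le> Hf M t (Ilow M t)"
      using S_props[OF t] Ilow_props(1)[of t] by (intro S_props(4)[OF t]) auto
    moreover have "Ccost M t (Ilow M t) \<le> Ccost M t z"
      using Ilow_props(3)[of t] 2 by (intro Ccost_anti[OF t'(1)]) auto
    ultimately show ?thesis using H_below_Ilow[OF t, of z] H_below_Ilow[OF t, of "Ilow M t"] 2 by simp
  next
    case 3
    then show ?thesis using z by (intro S_props(4)[OF t]) auto
  next
    case 4
    \<comment> \<open>Beyond SU the one-period cost exceeds that at \<open>zn0\<close> by more than
      K_t, while the future cost can be better by at most alpha K_{t+1} \<le> K_t. As the last grid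
      point strictly below the minimizer, \<open>zn0\<close> is a candidate.\<close>
    let ?n = "zn0 M t"
    have n: "?n \<in> Zgrid M" "?n < SU M t" using zn0_props zn0_less_SU[OF t'(1)] by auto
    have "Ilow M t \<le> ?n"
      using zn0_props[of t] Ilow_props[of t] Zgrid_gap[of ?n "Ilow M t"] by force
    then have "Hf M t (Sf M t) \<le> Hf M t ?n" using n by (intro S_props(4)[OF t]) auto
    also have "\<dots> \<le> Hf M t z"
    proof -
      have "Ed t ?V ?n \<le> ?K + Ed t ?V z"
        using n z 4 Vle Zgrid_diff rd_Zgrid by (intro Ed_leI[OF t'(1)] const_below_V) auto
      then have "alpha M * Ed t ?V ?n \<le> alpha M * (?K + Ed t ?V z)"
        using alpha by (intro mult_left_mono) auto
      moreover have "Ccost M t ?n + setupK M t < Ccost M t z"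
        using 4 by (intro Ccost_above_SU[OF t'(1)]) auto
      ultimately show ?thesis using Kdec[OF t] unfolding H_rec[OF t] by (simp add: algebra_simps)
    qed
    finally show ?thesis .
  qed
qed

lemma V_grid_regular: "t < hor M \<Longrightarrow> V_grid_regular t"
proof (induction rule: backward_induct)
  case last
  show ?case by (rule V_grid_regular_last)
next
  case (step t)
  note p = policy_step[OF step]
  show ?case
    unfolding V_grid_regular_def V_eq_policy_V[OF p]
    using sS_policy.V_kconvex[OF p] sS_policy.V_le_K_plus[OF p] by auto
qed

lemma policy: "t + 2 \<le> hor M \<Longrightarrow> sS_policy (Zgrid M) (setupK M t) (Hf M t) (sf M t) (Sf M t)"
  by (rule policy_step[OF _ V_grid_regular]) auto

section \<open>The optimality equation\<close>

text \<open>Adding the linear term turns the optimality equation into one with one-period costs C_t: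
  B_t(x) = inf over y \<ge> x of K_t delta(y - x) + J_t(y).\<close>

definition B :: "nat \<Rightarrow> real \<Rightarrow> real" where
  "B t x = vopt M t x + cst M t * x"

definition J :: "nat \<Rightarrow> real \<Rightarrow> real" where
  "J t y = Ccost M t y + alpha M * (\<integral>d. B (Suc t) (y - d) \<partial>dem M t)"

lemma B_hor: "B (hor M) x = 0"
  by (simp add: B_def vopt_def)

lemma B_integrable:
  assumes t: "t < hor M"
  shows "integrable (dem M t) (\<lambda>d. B (Suc t) (y - d))"
proof -
  interpret prob_space "dem M t" by (rule prob[OF t])
  show ?thesis unfolding B_def using finexp[OF t] mean[OF t] by auto
qed

lemma vopt_rec:
  assumes t: "t < hor M"
  shows "vopt M t x = Inf ((\<lambda>y. setupK M t * delta (y - x) + J t y - cst M t * x) ` {x..})"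
proof -
  interpret prob_space "dem M t" by (rule prob[OF t])
  define n where "n = hor M - Suc t"
  have n: "hor M - t = Suc n" "hor M - Suc n = t" "hor M - Suc t = n" using t by (auto simp: n_def)
  \<comment> \<open>The linear term of B contributes c_{t+1} (y - E D), which cancels against the
    terms with c_{t+1} in \<open>Ccost\<close>.\<close>
  have "(\<integral>d. B (Suc t) (y - d) \<partial>dem M t) =
      (\<integral>d. vopt M (Suc t) (y - d) \<partial>dem M t) + cst M (Suc t) * (y - Emean M t)" for y
    unfolding B_def Emean_def using finexp[OF t] mean[OF t] prob_space by simp
  then have e: "setupK M t * delta (y - x) + J t y - cst M t * x = setupK M t * delta (y - x)
      + cst M t * (y - x) + Gf M t y + alpha M * (\<integral>d. vopt M (Suc t) (y - d) \<partial>dem M t)" for y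
    unfolding J_def Ccost_def by (simp only:) (simp add: algebra_simps)
  show ?thesis unfolding e by (simp add: vopt_def n)
qed

lemma B_ge:
  assumes t: "t < hor M" and le: "\<And>y. x \<le> y \<Longrightarrow> L \<le> setupK M t * delta (y - x) + J t y"
  shows "L \<le> B t x"
proof -
  have "L - cst M t * x \<le> vopt M t x"
    unfolding vopt_rec[OF t]
  proof (rule cInf_greatest)
    fix u assume "u \<in> (\<lambda>y. setupK M t * delta (y - x) + J t y - cst M t * x) ` {x..}"
    then obtain y where "x \<le> y" "u = setupK M t * delta (y - x) + J t y - cst M t * x" by auto
    then show "L - cst M t * x \<le> u" using le[of y] by simp
  qed auto
  then show ?thesis by (simp add: B_def)
qed

lemma delta_nonneg: "0 \<le> delta u" and delta_le_1: "delta u \<le> 1"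
  by (simp_all add: delta_def)

lemma J_ge_const:
  assumes t: "t < hor M" and L: "\<And>x. L \<le> B (Suc t) x"
  shows "Ccost M t (Cmin M t) + alpha M * L \<le> J t y"
proof -
  interpret prob_space "dem M t" by (rule prob[OF t])
  have "(\<integral>d. L \<partial>dem M t) \<le> (\<integral>d. B (Suc t) (y - d) \<partial>dem M t)"
    using B_integrable[OF t] L by (intro integral_mono) auto
  then have "alpha M * L \<le> alpha M * (\<integral>d. B (Suc t) (y - d) \<partial>dem M t)"
    using alpha prob_space by (intro mult_left_mono) auto
  then show ?thesis using Cmin_le[OF t, of y] by (simp add: J_def)
qed

text \<open>A real \<open>Inf\<close> is a lower bound only for sets bounded below, so
  \<open>B_le\<close> depends on this. Each stage adds the minimum of C to the discounted bound of
  the next.\<close>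

lemma B_bounded_below:
  assumes "t \<le> hor M" shows "\<exists>L. \<forall>x. L \<le> B t x"
  using assms
proof (induction rule: inc_induct)
  case base
  show ?case using B_hor by (intro exI[of _ 0]) simp
next
  case (step n)
  then obtain L where L: "\<And>x. L \<le> B (Suc n) x" by blast
  have n: "n < hor M" using step.hyps by simp
  show ?case
  proof (intro exI allI B_ge[OF n])
    fix x y
    have "0 \<le> setupK M n * delta (y - x)" using Kpos[OF n] delta_nonneg by simp
    then show "Ccost M n (Cmin M n) + alpha M * L \<le> setupK M n * delta (y - x) + J n y"
      using J_ge_const[OF n L, of y] by linarith
  qed
qed

lemma B_le:
  assumes t: "t < hor M" and "x \<le> y"
  shows "B t x \<le> setupK M t * delta (y - x) + J t y"
proof -
  have "Suc t \<le> hor M" using t by simp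
  then obtain L where L: "\<And>x. L \<le> B (Suc t) x" using B_bounded_below by blast
  have "vopt M t x \<le> setupK M t * delta (y - x) + J t y - cst M t * x"
    unfolding vopt_rec[OF t]
  proof (rule cInf_lower)
    show "bdd_below ((\<lambda>y. setupK M t * delta (y - x) + J t y - cst M t * x) ` {x..})"
    proof (rule bdd_belowI2)
      fix y
      have "0 \<le> setupK M t * delta (y - x)" using Kpos[OF t] delta_nonneg by simp
      then show "Ccost M t (Cmin M t) + alpha M * L - cst M t * x
          \<le> setupK M t * delta (y - x) + J t y - cst M t * x"
        using J_ge_const[OF t L, of y] by linarith
    qed
  qed (use assms in auto)
  then show ?thesis by (simp add: B_def)
qed

lemma B_le_J: "t < hor M \<Longrightarrow> B t x \<le> J t x"
  using B_le[of t x x] by (simp add: delta_def)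

lemma B_le_K_J: "t < hor M \<Longrightarrow> x \<le> y \<Longrightarrow> B t x \<le> setupK M t + J t y"
  using B_le[of t x y] Kpos[of t] by (simp add: delta_def split: if_splits)

text \<open>Every level admissible from y can also be ordered up to from x, at an extra setup cost
  of at most K.\<close>

lemma B_le_K_B:
  assumes t: "t < hor M" and xy: "x \<le> y"
  shows "B t x \<le> setupK M t + B t y"
proof -
  have "B t x - setupK M t \<le> B t y"
  proof (rule B_ge[OF t])
    fix w assume "y \<le> w"
    moreover have "0 \<le> setupK M t * delta (w - y)" using Kpos[OF t] delta_nonneg by simp
    ultimately show "B t x - setupK M t \<le> setupK M t * delta (w - y) + J t w"
      using B_le_K_J[OF t, of x w] xy by simp
  qed
  then show ?thesis by simp
qed

text \<open>The exact equation C(s) = C(S) + K removes the jump at s, so that V inherits the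
  Lipschitz constant of C in this period.\<close>

lemma V_last: "Vf M (hor M - 1) y = Ccost M (hor M - 1) (max y (sf M (hor M - 1)))"
proof -
  have "Vf M (hor M - 1) y = (if y < sT1 M then Ccost M (hor M - 1) (sT1 M) else Ccost M (hor M - 1) y)"
    using sT1_props(2) by (simp del: One_nat_def add: Vf_def H_last S_last s_last)
  then show ?thesis unfolding s_last by (simp add: max_def)
qed

lemma V_last_lipschitz: "\<bar>Vf M (hor M - 1) u - Vf M (hor M - 1) v\<bar> \<le> gam M (hor M - 1) * \<bar>u - v\<bar>"
proof -
  have t: "hor M - 1 < hor M" using hor by simp
  let ?s = "sf M (hor M - 1)"
  have "\<bar>Vf M (hor M - 1) u - Vf M (hor M - 1) v\<bar> \<le> gam M (hor M - 1) * \<bar>max u ?s - max v ?s\<bar>"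
    unfolding V_last by (rule lip[OF t])
  also have "\<dots> \<le> gam M (hor M - 1) * \<bar>u - v\<bar>"
    using gam[OF t] by (intro mult_left_mono) auto
  finally show ?thesis .
qed

text \<open>With zero terminal cost J is C itself, and an (s, S) policy is optimal for a convex C.
  The error recursions therefore start from zero.\<close>

lemma B_last: "B (hor M - 1) x = Vf M (hor M - 1) x"
proof -
  let ?t = "hor M - 1"
  have t: "?t < hor M" and Suc: "Suc ?t = hor M" using hor by auto
  have JC: "J ?t y = Ccost M ?t y" for y unfolding J_def Suc by (simp add: B_hor)
  have V: "Vf M ?t y = (if y < sT1 M then Ccost M ?t (Cmin M ?t) + setupK M ?t else Ccost M ?t y)" for y
    by (simp del: One_nat_def add: Vf_def H_last S_last s_last)
  show ?thesis
  proof (rule antisym)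
    show "B ?t x \<le> Vf M ?t x"
      using B_le_K_J[OF t, of x "Cmin M ?t"] B_le_J[OF t, of x] sT1_props(1)
      by (cases "x < sT1 M") (simp_all del: One_nat_def add: V JC add.commute)
    show "Vf M ?t x \<le> B ?t x"
    proof (rule B_ge[OF t])
      fix y assume xy: "x \<le> y"
      show "Vf M ?t x \<le> setupK M ?t * delta (y - x) + J ?t y"
      proof (cases "x = y")
        case True
        then show ?thesis
          using Ccost_anti[OF t, of x "sT1 M"] sT1_props by (auto simp del: One_nat_def simp: V JC delta_def)
      next
        case False
        then have d: "delta (y - x) = 1" using xy by (simp add: delta_def)
        have "Vf M ?t x \<le> setupK M ?t + Ccost M ?t y"
        proof (cases "x \<le> Cmin M ?t")
          case True
          then have "Vf M ?t x \<le> setupK M ?t + Ccost M ?t (Cmin M ?t)"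
            using Ccost_anti[OF t, of "sT1 M" x] sT1_props by (auto simp del: One_nat_def simp: V)
          then show ?thesis using Cmin_le[OF t, of y] by simp
        next
          case False
          then show ?thesis
            using Ccost_mono[OF t, of x y] xy Kpos[OF t] sT1_props(1) by (simp del: One_nat_def add: V)
        qed
        then show ?thesis by (simp del: One_nat_def add: d JC)
      qed
    qed
  qed
qed

section \<open>Moduli of continuity of the approximate value functions\<close>

definition psib :: "real \<Rightarrow> nat \<Rightarrow> real \<Rightarrow> real \<Rightarrow> real" where
  "psib b t = fst (estaux M b (hor M - 1 - t))"

definition phib :: "real \<Rightarrow> nat \<Rightarrow> real \<Rightarrow> real \<Rightarrow> real" where
  "phib b t = snd (estaux M b (hor M - 1 - t))"

lemma psi_psib: "psi M = psib 0" and psibar_psib: "psibar M = psib (theta M)"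
  by (simp_all add: fun_eq_iff psi_def psibar_def psib_def)

lemma psib_last: "psib b (hor M - 1) x y = gam M (hor M - 1) * x"
  and phib_last: "phib b (hor M - 1) x y = (if y < sf M (hor M - 1) then 0 else gam M (hor M - 1) * x)"
  by (simp_all add: psib_def phib_def)

lemma index_obtain:
  assumes "t + 2 \<le> hor M"
  obtains n where "hor M - 1 - t = Suc n" "hor M - Suc (Suc n) = t" "hor M - 1 - Suc t = n"
  by (rule that[of "hor M - 2 - t"]) (use assms in auto)

lemma phib_rec:
  assumes t: "t + 2 \<le> hor M"
  shows "phib b t x y = (if y < sf M t then 0
    else if y - x < sf M t then psib b t (y - sf M t + b) y else psib b t x y)"
proof -
  obtain n where n: "hor M - 1 - t = Suc n" "hor M - Suc (Suc n) = t" "hor M - 1 - Suc t = n"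
    using index_obtain[OF t] .
  show ?thesis unfolding phib_def psib_def n estaux.simps Let_def by (simp only: n fst_conv snd_conv)
qed

lemma phib_below: "t < hor M \<Longrightarrow> y < sf M t \<Longrightarrow> phib b t x y = 0"
  using phib_last[of b x y] phib_rec[of t b x y] by (cases "t = hor M - 1") auto

lemma const_below_phib: "t < hor M \<Longrightarrow> const_below (phib b t x)"
  unfolding const_below_def using phib_below by blast

lemma nidx_bounds: "zg M (nidx M u - 1) \<le> u" "u < zg M (nidx M u)"
proof -
  have "zg M (nidx M u - 1) \<le> u \<and> u < zg M (nidx M u)"
    unfolding nidx_def
  proof (rule theI')
    obtain w where w: "w \<in> Zgrid M" "w \<le> u" "u < w + theta M" by (rule Zgrid_floor)
    obtain m where m: "w = zg M m" using w(1) by (rule ZgridE)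
    show "\<exists>!n. zg M (n - 1) \<le> u \<and> u < zg M n"
    proof (rule ex1I)
      show "zg M (m + 1 - 1) \<le> u \<and> u < zg M (m + 1)" using w by (simp add: m zg_plus1)
      fix n assume "zg M (n - 1) \<le> u \<and> u < zg M n"
      then have "zg M (n - 1) < zg M (m + 1)" "zg M m < zg M n"
        using w unfolding m zg_plus1 by linarith+
      then show "n = m + 1" by simp
    qed
  qed
  then show "zg M (nidx M u - 1) \<le> u" "u < zg M (nidx M u)" by auto
qed

text \<open>Both the case split and the truncated sum in the definition disappear because phi_{t+1}
  vanishes below s_{t+1}: the omitted terms are zero, and for y < s_{t+1} - theta none is
  left.\<close>

lemma psib_rec:
  assumes t: "t + 2 \<le> hor M"
  shows "psib b t x y = gam M t * x + alpha M * Ed t (phib b (Suc t) x) y"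
proof -
  obtain n where n: "hor M - 1 - t = Suc n" "hor M - Suc (Suc n) = t" "hor M - 1 - Suc t = n"
    using index_obtain[OF t] .
  have t': "t < hor M" "Suc t < hor M" using t by auto
  let ?h = "phib b (Suc t) x" and ?s = "sf M (Suc t)"
  define N where "N = nidx M (y - ?s)"
  have psi: "psib b t x y = (if y < ?s - theta M then gam M t * x
      else gam M t * x + alpha M * (\<Sum>m\<in>{-1..N - 1}. ?h (y - zg M m) * fprob M t m))"
    unfolding phib_def psib_def N_def n estaux.simps Let_def by (simp only: n fst_conv snd_conv)
  have zero: "?h (y - zg M m) = 0" if "N \<le> m" for m
  proof -
    have "zg M N \<le> zg M m" using that by simp
    then have "y - zg M m < ?s" using nidx_bounds(2)[of "y - ?s"] unfolding N_def by linarith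
    then show ?thesis by (rule phib_below[OF t'(2)])
  qed
  have "Ed t ?h y = sum_from_m1 (\<lambda>m. ?h (y - zg M m) * fprob M t m)"
    using Ed_integrable_sum(2)[OF t'(1) const_below_phib[OF t'(2)]] by simp
  also have "\<dots> = (\<Sum>j<nat (N + 1). ?h (y - zg M (int j - 1)) * fprob M t (int j - 1))"
    unfolding sum_from_m1_def by (rule suminf_finite) (auto intro!: zero)
  also have "\<dots> = (\<Sum>m\<in>{-1..N - 1}. ?h (y - zg M m) * fprob M t m)"
    by (rule sum.reindex_bij_witness[of _ "\<lambda>m. nat (m + 1)" "\<lambda>j. int j - 1"]) auto
  finally have Ed: "Ed t ?h y = (\<Sum>m\<in>{-1..N - 1}. ?h (y - zg M m) * fprob M t m)" .
  show ?thesis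
  proof (cases "y < ?s - theta M")
    case True
    then have "zg M (N - 1) < zg M (-1)"
      using nidx_bounds(1)[of "y - ?s"] unfolding N_def zg_m1 by linarith
    then have "{-1..N - 1} = {}" by simp
    then have "Ed t ?h y = 0" unfolding Ed by simp
    then show ?thesis using True psi by simp
  next
    case False
    then show ?thesis using psi Ed by simp
  qed
qed

lemma Ed_nonneg: "(\<And>y. 0 \<le> h y) \<Longrightarrow> 0 \<le> Ed t h y"
  unfolding Ed_def by simp

lemma psib_phib_nonneg:
  assumes "t < hor M" "0 \<le> b" "0 \<le> x"
  shows "0 \<le> psib b t x y" "0 \<le> phib b t x y"
proof -
  have "\<forall>x y. 0 \<le> x \<longrightarrow> 0 \<le> psib b t x y \<and> 0 \<le> phib b t x y"
    using assms(1)
  proof (induction rule: backward_induct)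
    case last
    have "0 \<le> gam M (hor M - 1)" using gam[of "hor M - 1"] hor by simp
    then show ?case by (simp del: One_nat_def add: psib_last phib_last)
  next
    case (step t)
    have psi: "0 \<le> psib b t x y" if "0 \<le> x" for x y
      using Ed_nonneg[of "phib b (Suc t) x" t y] step that gam[of t] alpha
      by (auto simp: psib_rec[OF step(1)])
    show ?case
    proof (intro allI impI conjI)
      fix x y :: real assume "0 \<le> x"
      then show "0 \<le> psib b t x y" by (rule psi)
      show "0 \<le> phib b t x y"
        unfolding phib_rec[OF step(1)] using psi \<open>0 \<le> x\<close> assms(2) by auto
    qed
  qed
  then show "0 \<le> psib b t x y" "0 \<le> phib b t x y" using assms(3) by auto
qed

lemma phib_nonneg: "t < hor M \<Longrightarrow> 0 \<le> b \<Longrightarrow> 0 \<le> phib b t (theta M) y"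
  using psib_phib_nonneg(2) theta by simp

text \<open>A grid point above the grid point s lies at least theta above it, so the middle branch
  of phi cannot apply.\<close>

lemma phib_grid:
  assumes t: "t + 2 \<le> hor M" and z: "z \<in> Zgrid M" "sf M t < z"
  shows "phib b t (theta M) z = psib b t (theta M) z"
  using Zgrid_gap[OF s_props(1)[OF t] z] z by (simp add: phib_rec[OF t])

text \<open>At z = s the middle branch applies with argument z - s + theta = theta: the barred shift
  is just what includes the point s.\<close>

lemma phibar_grid:
  assumes t: "t + 2 \<le> hor M" and z: "z \<in> Zgrid M" "sf M t \<le> z"
  shows "phib (theta M) t (theta M) z = psib (theta M) t (theta M) z"
  using phib_grid[OF t z(1)] z(2) theta by (cases "z = sf M t") (auto simp: phib_rec[OF t])

lemma Ed_le_add: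
  assumes t: "t < hor M" and h: "const_below h" "const_below h1" "const_below h2"
    and le: "\<And>d. 0 \<le> d \<Longrightarrow> h (y - rd d) \<le> h1 (y1 - rd d) + c * h2 (y2 - rd d)"
  shows "Ed t h y \<le> Ed t h1 y1 + c * Ed t h2 y2"
proof -
  have i: "integrable (dem M t) (\<lambda>d. h (y - rd d))" "integrable (dem M t) (\<lambda>d. h1 (y1 - rd d))"
    "integrable (dem M t) (\<lambda>d. h2 (y2 - rd d))"
    by (auto intro: Ed_integrable_sum(1)[OF t] h)
  have "AE d in dem M t. h (y - rd d) \<le> h1 (y1 - rd d) + c * h2 (y2 - rd d)"
    using nonneg[OF t] by (rule AE_mp) (auto intro: le)
  then have "Ed t h y \<le> (\<integral>d. h1 (y1 - rd d) + c * h2 (y2 - rd d) \<partial>dem M t)"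
    unfolding Ed_def using i by (intro integral_mono_AE) auto
  also have "\<dots> = Ed t h1 y1 + c * Ed t h2 y2"
    using i by (simp add: Ed_def)
  finally show ?thesis .
qed

lemma H_diff_le:
  assumes t: "t + 2 \<le> hor M" and h: "const_below h"
    and le: "\<And>d. 0 \<le> d \<Longrightarrow> Vf M (Suc t) (v - rd d) - Vf M (Suc t) (u - rd d) \<le> c * h (z - rd d)"
  shows "Hf M t v - Hf M t u \<le> Ccost M t v - Ccost M t u + alpha M * (c * Ed t h z)"
proof -
  have t': "t < hor M" using t by simp
  have "Ed t (Vf M (Suc t)) v \<le> Ed t (Vf M (Suc t)) u + c * Ed t h z"
    using le by (intro Ed_le_add[OF t' const_below_V const_below_V h]) (simp add: diff_le_eq add.commute)
  then have "alpha M * Ed t (Vf M (Suc t)) v \<le> alpha M * (Ed t (Vf M (Suc t)) u + c * Ed t h z)"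
    using alpha by (intro mult_left_mono) auto
  then show ?thesis unfolding H_rec[OF t] by (simp add: algebra_simps)
qed

lemma Ccost_diff_theta:
  assumes "t < hor M" "\<bar>u - v\<bar> \<le> theta M"
  shows "Ccost M t u - Ccost M t v \<le> gam M t * theta M"
proof -
  have "Ccost M t u - Ccost M t v \<le> gam M t * \<bar>u - v\<bar>" using lip[OF assms(1), of u v] by simp
  also have "\<dots> \<le> gam M t * theta M" using gam[OF assms(1)] assms(2) by (intro mult_left_mono) auto
  finally show ?thesis .
qed

lemma V_last_diff:
  assumes "\<bar>u - v\<bar> \<le> theta M" "max u v \<le> z" "0 \<le> b"
  shows "Vf M (hor M - 1) u - Vf M (hor M - 1) v \<le> phib b (hor M - 1) (theta M) z"
proof (cases "z < sf M (hor M - 1)")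
  case True
  then have "max u (sf M (hor M - 1)) = max v (sf M (hor M - 1))" using assms(2) by simp
  then show ?thesis
    using phib_nonneg[of "hor M - 1" b z] hor assms(3) by (simp del: One_nat_def add: V_last)
next
  case False
  have t: "hor M - 1 < hor M" using hor by simp
  have "Vf M (hor M - 1) u - Vf M (hor M - 1) v \<le> gam M (hor M - 1) * \<bar>u - v\<bar>"
    using V_last_lipschitz[of u v] by simp
  also have "\<dots> \<le> gam M (hor M - 1) * theta M"
    using gam[OF t] assms(1) by (intro mult_left_mono) auto
  finally show ?thesis using False by (simp del: One_nat_def add: phib_last)
qed

section \<open>Upward increments of V_t and H_t\<close>

definition V_increase_bound :: "real \<Rightarrow> nat \<Rightarrow> bool" where
  "V_increase_bound b t \<longleftrightarrow> (\<forall>u v z. u \<le> v \<longrightarrow> v \<le> u + theta M \<longrightarrow> z \<in> Zgrid M \<longrightarrow> v \<le> z \<longrightarrow>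
     Vf M t v - Vf M t u \<le> phib b t (theta M) z)"

lemma V_increase_boundD:
  "V_increase_bound b t \<Longrightarrow> u \<le> v \<Longrightarrow> v \<le> u + theta M \<Longrightarrow> z \<in> Zgrid M \<Longrightarrow> v \<le> z \<Longrightarrow>
     Vf M t v - Vf M t u \<le> phib b t (theta M) z"
  unfolding V_increase_bound_def by blast

text \<open>The difference of C is kept rather than bounded by gamma_t theta, so that
  \<open>V_le_order_up_to\<close> can combine it with a second one.\<close>

lemma H_increase_aux:
  assumes t: "t + 2 \<le> hor M" and ok: "V_increase_bound b (Suc t)"
    and uv: "u \<le> v" "v \<le> u + theta M" "z \<in> Zgrid M" "v \<le> z"
  shows "Hf M t v - Hf M t u \<le> Ccost M t v - Ccost M t u + (psib b t (theta M) z - gam M t * theta M)"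
proof -
  have t': "t < hor M" "Suc t < hor M" using t by auto
  have "Hf M t v - Hf M t u \<le> Ccost M t v - Ccost M t u
      + alpha M * (1 * Ed t (phib b (Suc t) (theta M)) z)"
  proof (rule H_diff_le[OF t const_below_phib[OF t'(2)]])
    fix d :: real assume "0 \<le> d"
    show "Vf M (Suc t) (v - rd d) - Vf M (Suc t) (u - rd d) \<le> 1 * phib b (Suc t) (theta M) (z - rd d)"
      using uv V_increase_boundD[OF ok, of "u - rd d" "v - rd d" "z - rd d"] Zgrid_diff[OF _ rd_Zgrid] by simp
  qed
  then show ?thesis by (simp add: psib_rec[OF t])
qed

text \<open>Crossing s to the right V can only drop at the jump, since H s \<le> H S + K; an
  increment that starts below s is thus dominated by the increment of H from s on. Both b = 0 and b
  = theta are used later.\<close>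

lemma V_increase_bound:
  assumes "t < hor M" "0 \<le> b"
  shows "V_increase_bound b t"
  using assms(1)
proof (induction rule: backward_induct)
  case last
  show ?case
    unfolding V_increase_bound_def using assms(2) theta by (intro allI impI V_last_diff) auto
next
  case (step t)
  note t = step(1) and s = s_props[OF step(1)]
  have t': "t < hor M" using t by simp
  have H: "Hf M t v - Hf M t u \<le> psib b t (theta M) z"
    if "u \<le> v" "v \<le> u + theta M" "z \<in> Zgrid M" "v \<le> z" for u v z
    using H_increase_aux[OF step that] Ccost_diff_theta[OF t', of v u] that by simp
  show ?case
    unfolding V_increase_bound_def
  proof (intro allI impI)
    fix u v z assume *: "u \<le> v" "v \<le> u + theta M" "z \<in> Zgrid M" "v \<le> z"
    have nn: "0 \<le> phib b t (theta M) z" using phib_nonneg[OF t' assms(2)] .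
    consider "v < sf M t" | "v = sf M t" | "sf M t < v" by linarith
    then show "Vf M t v - Vf M t u \<le> phib b t (theta M) z"
    proof cases
      case 1
      then show ?thesis using nn * by (simp add: Vf_def)
    next
      case 2
      then show ?thesis using nn * s(4) by (auto simp: Vf_def)
    next
      case 3
      then have z: "phib b t (theta M) z = psib b t (theta M) z" using * by (intro phib_grid[OF t]) auto
      show ?thesis
      proof (cases "u < sf M t")
        case True
        then have "Hf M t v - Hf M t (sf M t) \<le> psib b t (theta M) z" using * 3 by (intro H) auto
        then show ?thesis using True 3 s(4) by (simp add: z Vf_def)
      next
        case False
        then show ?thesis using H[OF *] 3 by (simp add: z Vf_def)
      qed
    qed
  qed
qed

lemmas V_increase = V_increase_boundD[OF V_increase_bound]
lemmas H_increase = H_increase_aux[OF _ V_increase_bound]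

section \<open>Downward increments of V_t and H_t\<close>

abbreviation "psibt t z \<equiv> psib (theta M) t (theta M) z"
abbreviation "phibt t z \<equiv> phib (theta M) t (theta M) z"

lemma H_decrease_aux:
  assumes t: "t + 2 \<le> hor M"
    and V: "\<And>w u z. w \<in> Zgrid M \<Longrightarrow> w \<le> u \<Longrightarrow> u \<le> w + theta M \<Longrightarrow> z \<in> Zgrid M \<Longrightarrow> u \<le> z \<Longrightarrow>
      Vf M (Suc t) w - Vf M (Suc t) u \<le> phibt (Suc t) z"
    and wu: "w \<in> Zgrid M" "w \<le> u" "u \<le> w + theta M" "z \<in> Zgrid M" "u \<le> z"
  shows "Hf M t w - Hf M t u \<le> psibt t z"
proof -
  have t': "t < hor M" "Suc t < hor M" using t by auto
  have "Hf M t w - Hf M t u \<le> Ccost M t w - Ccost M t u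
      + alpha M * (1 * Ed t (phib (theta M) (Suc t) (theta M)) z)"
  proof (rule H_diff_le[OF t const_below_phib[OF t'(2)]])
    fix d :: real assume "0 \<le> d"
    show "Vf M (Suc t) (w - rd d) - Vf M (Suc t) (u - rd d) \<le> 1 * phibt (Suc t) (z - rd d)"
      using wu V[of "w - rd d" "u - rd d" "z - rd d"] Zgrid_diff[OF _ rd_Zgrid] by simp
  qed
  then show ?thesis using Ccost_diff_theta[OF t'(1), of w u] wu by (simp add: psib_rec[OF t])
qed

text \<open>If the step straddles s, then w on the grid forces u = s and w = s - theta, and H w
  \<ge> H S + K turns the jump of V into a decrement of H over a full cell.\<close>

lemma V_decrease:
  assumes "t < hor M" "w \<in> Zgrid M" "w \<le> u" "u \<le> w + theta M" "z \<in> Zgrid M" "u \<le> z"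
  shows "Vf M t w - Vf M t u \<le> phibt t z"
  using assms
proof (induction arbitrary: w u z rule: backward_induct)
  case last
  then show ?case using theta by (intro V_last_diff) auto
next
  case (step t)
  note t = step(1) and s = s_props[OF step(1)]
  have t': "t < hor M" using t by simp
  have nn: "0 \<le> phibt t z" using phib_nonneg[OF t', of "theta M" z] theta by simp
  note H = H_decrease_aux[OF t step.IH]
  consider "u < sf M t" | "sf M t \<le> w" | "w < sf M t" "sf M t \<le> u" by linarith
  then show ?case
  proof cases
    case 1
    then show ?thesis using nn step.prems by (simp add: Vf_def)
  next
    case 2
    then have "phibt t z = psibt t z" using step.prems by (intro phibar_grid[OF t]) auto
    then show ?thesis using H[OF _ _ _ _ _ step.prems] 2 step.prems by (simp add: Vf_def)
  next
    case 3
    have u: "u = sf M t" using Zgrid_gap[OF step.prems(1) s(1) 3(1)] 3 step.prems by simp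
    have z: "phibt t z = psibt t z" using step.prems u by (intro phibar_grid[OF t]) auto
    have "Hf M t (Sf M t) + setupK M t \<le> Hf M t w"
      by (rule H_ge_below_s[OF t step.prems(1) 3(1)])
    then show ?thesis using H[OF _ _ _ _ _ step.prems] 3 by (simp add: Vf_def z u)
  qed
qed

lemma H_decrease:
  assumes t: "t + 2 \<le> hor M" and "w \<in> Zgrid M" "w \<le> u" "u \<le> w + theta M" "z \<in> Zgrid M" "u \<le> z"
  shows "Hf M t w - Hf M t u \<le> psibt t z"
  using assms V_decrease[of "Suc t"] by (intro H_decrease_aux) auto

text \<open>Off the grid the jump of V_t at s_t may be followed by a further descent over one cell,
  whence the factor 2.\<close>

lemma V_decrease_off_grid:
  assumes "t < hor M" "u \<le> v" "v \<le> u + theta M" "z \<in> Zgrid M" "v \<le> z"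
  shows "Vf M t u - Vf M t v \<le> 2 * phibt t z"
  using assms
proof (induction arbitrary: u v z rule: backward_induct)
  case last
  have "0 \<le> phibt (hor M - 1) z" using phib_nonneg[of "hor M - 1" "theta M" z] theta hor by simp
  moreover have "Vf M (hor M - 1) u - Vf M (hor M - 1) v \<le> phibt (hor M - 1) z"
    using last theta by (intro V_last_diff) auto
  ultimately show ?case by simp
next
  case (step t)
  note t = step(1) and s = s_props[OF step(1)]
  have t': "t < hor M" "Suc t < hor M" using t by auto
  have nn: "0 \<le> phibt t z" using phib_nonneg[OF t'(1), of "theta M" z] theta by simp
  consider "v < sf M t" | "sf M t \<le> u" | "u < sf M t" "sf M t \<le> v" by linarith
  then show ?case
  proof cases
    case 1
    then show ?thesis using nn step.prems by (simp add: Vf_def)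
  next
    case 2
    then have z: "phibt t z = psibt t z" using step.prems by (intro phibar_grid[OF t]) auto
    have "Hf M t u - Hf M t v \<le> Ccost M t u - Ccost M t v
        + alpha M * (2 * Ed t (phib (theta M) (Suc t) (theta M)) z)"
    proof (rule H_diff_le[OF t const_below_phib[OF t'(2)]])
      fix d :: real assume "0 \<le> d"
      show "Vf M (Suc t) (u - rd d) - Vf M (Suc t) (v - rd d) \<le> 2 * phibt (Suc t) (z - rd d)"
        using step.prems Zgrid_diff[OF _ rd_Zgrid] by (intro step.IH) auto
    qed
    moreover have "Ccost M t u - Ccost M t v \<le> gam M t * theta M"
      using step.prems by (intro Ccost_diff_theta[OF t'(1)]) auto
    \<comment> \<open>Only the expectation is doubled; C contributes gamma_t theta once, while
      \<open>2 * psibt t z\<close> contains it twice.\<close>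
    ultimately have "Hf M t u - Hf M t v \<le> 2 * psibt t z - gam M t * theta M"
      by (simp add: psib_rec[OF t] algebra_simps)
    moreover have "0 \<le> gam M t * theta M" using gam[OF t'(1)] theta by simp
    ultimately show ?thesis using 2 step.prems by (simp add: Vf_def z)
  next
    case 3
    have z: "phibt t z = psibt t z" using step.prems 3 by (intro phibar_grid[OF t]) auto
    \<comment> \<open>At the off-grid u nothing bounds H from below, so V u = H S + K is compared
      with H at the grid neighbour of s, followed by one step from s to v.\<close>
    let ?w = "sf M t - theta M"
    have w: "?w \<in> Zgrid M" using Zgrid_sub_theta[OF s(1)] .
    have "Hf M t (Sf M t) + setupK M t \<le> Hf M t ?w"
      using theta by (intro H_ge_below_s[OF t w]) auto
    moreover have "Hf M t ?w - Hf M t (sf M t) \<le> psibt t z"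
      using step.prems 3 theta by (intro H_decrease[OF t w]) auto
    moreover have "Hf M t (sf M t) - Hf M t v \<le> psibt t z"
      using step.prems 3 by (intro H_decrease[OF t s(1)]) auto
    ultimately show ?thesis using 3 by (simp add: Vf_def z)
  qed
qed

section \<open>Error propagation\<close>

definition omega :: "nat \<Rightarrow> real \<Rightarrow> real" where
  "omega t = fst (omaux M (hor M - 1 - t))"

definition eta :: "nat \<Rightarrow> real" where
  "eta t = snd (snd (omaux M (hor M - 1 - t)))"

lemma omegabar_last: "omegabar M (hor M - 1) = (\<lambda>x. 0)"
  by (simp add: omegabar_def)

lemma omegabar_rec:
  assumes t: "t + 2 \<le> hor M"
  shows "omegabar M t = (\<lambda>x. if x \<le> SU M t then eta t else max (eta t) (omega t x))"
proof -
  obtain n where n: "hor M - 1 - t = Suc n" "hor M - Suc (Suc n) = t" "hor M - 1 - Suc t = n"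
    using index_obtain[OF t] .
  show ?thesis unfolding omegabar_def omega_def eta_def n omaux.simps Let_def by (simp only: n fst_conv snd_conv)
qed

lemma const_below_omegabar: "t < hor M \<Longrightarrow> const_below (omegabar M t)"
  unfolding const_below_def
  using omegabar_last omegabar_rec[of t]
  by (cases "t = hor M - 1", force) (intro exI[of _ "SU M t"] exI[of _ "eta t"], auto)

text \<open>Subtracting gamma_t theta from psi_t leaves the discounted expectation of phi_{t+1}, the
  cost of rounding the demand alone.\<close>

lemma omega_rec:
  assumes t: "t + 2 \<le> hor M"
  shows "omega t x = alpha M * Ed t (phib 0 (Suc t) (theta M)) x + alpha M * Ed t (omegabar M (Suc t)) x"
    and "eta t = psibt t (SU M t) + omega t (SU M t)"
proof -
  obtain n where n: "hor M - 1 - t = Suc n" "hor M - Suc (Suc n) = t" "hor M - 1 - Suc t = n"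
    using index_obtain[OF t] .
  have t': "t < hor M" "Suc t < hor M" using t by auto
  have "omega t x = psi M t (theta M) x - gam M t * theta M
      + alpha M * sum_from_m1 (\<lambda>m. omegabar M (Suc t) (x - zg M m) * fprob M t m)"
    unfolding omegabar_def omega_def n omaux.simps Let_def by (simp only: n fst_conv snd_conv)
  then show "omega t x = alpha M * Ed t (phib 0 (Suc t) (theta M)) x + alpha M * Ed t (omegabar M (Suc t)) x"
    unfolding Ed_integrable_sum(2)[OF t'(1) const_below_omegabar[OF t'(2)]] psi_psib psib_rec[OF t] by simp
  show "eta t = psibt t (SU M t) + omega t (SU M t)"
    unfolding psibar_psib[symmetric] omega_def eta_def n omaux.simps Let_def by (simp only: n fst_conv snd_conv)
qed

lemma lam_Suc: "lam M t z (Suc i) = lam M (Suc t) (max z (Sf M t) + theta M) i"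
  by (induction i) auto

lemma epsbar_last:
  assumes "t + 2 = hor M"
  shows "epsbar M t z = alpha M * gam M (hor M - 1) * theta M"
proof -
  have "hor M - 1 - t = 1" "hor M - 2 - t = 0" using assms by auto
  then show ?thesis unfolding epsbar_def by simp
qed

text \<open>Unrolls the closed sum from the front. For a grid point z, the new base point max z S +
  theta is again a grid point, above every level which the policy passes on when started at or below
  z.\<close>

lemma epsbar_rec:
  assumes t: "t + 3 \<le> hor M"
  shows "epsbar M t z = 2 * (psibt t (max z (Sf M t)) - gam M t * theta M)
    + alpha M * epsbar M (Suc t) (max z (Sf M t) + theta M)"
proof -
  define n where "n = hor M - 3 - t"
  have n: "hor M - 2 - t = Suc n" "hor M - 2 - Suc t = n" "hor M - 1 - t = Suc (Suc n)"
    "hor M - 1 - Suc t = Suc n" using t by (auto simp: n_def)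
  show ?thesis
    unfolding epsbar_def n sum.lessThan_Suc_shift psibar_psib lam_Suc
    by (simp add: sum_distrib_left algebra_simps)
qed

lemma B_expectation_le:
  assumes t: "t < hor M" and h: "const_below h1" "const_below h2"
    and le: "\<And>d. 0 \<le> d \<Longrightarrow> B (Suc t) (y - d) \<le> h1 (y1 - rd d) + c1 * h2 (y2 - rd d) + c"
  shows "(\<integral>d. B (Suc t) (y - d) \<partial>dem M t) \<le> Ed t h1 y1 + c1 * Ed t h2 y2 + c"
proof -
  interpret prob_space "dem M t" by (rule prob[OF t])
  have i: "integrable (dem M t) (\<lambda>d. h1 (y1 - rd d))" "integrable (dem M t) (\<lambda>d. h2 (y2 - rd d))"
    by (auto intro: Ed_integrable_sum(1)[OF t] h)
  have "AE d in dem M t. B (Suc t) (y - d) \<le> h1 (y1 - rd d) + c1 * h2 (y2 - rd d) + c"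
    using nonneg[OF t] by (rule AE_mp) (auto intro: le)
  then have "(\<integral>d. B (Suc t) (y - d) \<partial>dem M t) \<le> (\<integral>d. h1 (y1 - rd d) + c1 * h2 (y2 - rd d) + c \<partial>dem M t)"
    using i B_integrable[OF t] by (intro integral_mono_AE) auto
  also have "\<dots> = Ed t h1 y1 + c1 * Ed t h2 y2 + c"
    using i prob_space by (simp add: Ed_def)
  finally show ?thesis .
qed

lemma Ed_le_B_expectation:
  assumes t: "t < hor M" and h: "const_below h" "const_below h1" "const_below h2"
    and le: "\<And>d. 0 \<le> d \<Longrightarrow> h (w - rd d) \<le> B (Suc t) (y - d) + h1 (z - rd d) + h2 (z - rd d)"
  shows "Ed t h w \<le> (\<integral>d. B (Suc t) (y - d) \<partial>dem M t) + Ed t h1 z + Ed t h2 z"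
proof -
  have i: "integrable (dem M t) (\<lambda>d. h (w - rd d))" "integrable (dem M t) (\<lambda>d. h1 (z - rd d))"
    "integrable (dem M t) (\<lambda>d. h2 (z - rd d))"
    by (auto intro: Ed_integrable_sum(1)[OF t] h)
  have "AE d in dem M t. h (w - rd d) \<le> B (Suc t) (y - d) + h1 (z - rd d) + h2 (z - rd d)"
    using nonneg[OF t] by (rule AE_mp) (auto intro: le)
  then have "Ed t h w \<le> (\<integral>d. B (Suc t) (y - d) + h1 (z - rd d) + h2 (z - rd d) \<partial>dem M t)"
    unfolding Ed_def using i B_integrable[OF t] by (intro integral_mono_AE) auto
  also have "\<dots> = (\<integral>d. B (Suc t) (y - d) \<partial>dem M t) + Ed t h1 z + Ed t h2 z"
    using i B_integrable[OF t] by (simp add: Ed_def)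
  finally show ?thesis .
qed

section \<open>Lower error bound\<close>

definition lower_bound_at :: "nat \<Rightarrow> bool" where
  "lower_bound_at t \<longleftrightarrow> (\<forall>x z. z \<in> Zgrid M \<longrightarrow> x \<le> z \<longrightarrow> Vf M t x - B t x \<le> omegabar M t z)"

text \<open>At a common level y the costs C cancel. What remains is the upward move of the next
  level from y - d to y - rd d, by at most theta, and the error of the next period.\<close>

lemma H_le_J:
  assumes t: "t + 2 \<le> hor M" and ok: "lower_bound_at (Suc t)" and y: "z \<in> Zgrid M" "y \<le> z"
  shows "Hf M t y - J t y \<le> omega t z"
proof -
  have t': "t < hor M" "Suc t < hor M" using t by auto
  have "Ed t (Vf M (Suc t)) y \<le> (\<integral>d. B (Suc t) (y - d) \<partial>dem M t)
      + Ed t (phib 0 (Suc t) (theta M)) z + Ed t (omegabar M (Suc t)) z"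
  proof (rule Ed_le_B_expectation[OF t'(1) const_below_V const_below_phib[OF t'(2)] const_below_omegabar[OF t'(2)]])
    fix d :: real assume "0 \<le> d"
    have zd: "z - rd d \<in> Zgrid M" using y by (intro Zgrid_diff) auto
    have "Vf M (Suc t) (y - rd d) - Vf M (Suc t) (y - d) \<le> phib 0 (Suc t) (theta M) (z - rd d)"
      using y zd rd_less[of d] rd_ge[of d] by (intro V_increase[OF t'(2)]) auto
    moreover have "Vf M (Suc t) (y - d) - B (Suc t) (y - d) \<le> omegabar M (Suc t) (z - rd d)"
      using ok y zd rd_less[of d] unfolding lower_bound_at_def by auto
    ultimately show "Vf M (Suc t) (y - rd d) \<le> B (Suc t) (y - d)
        + phib 0 (Suc t) (theta M) (z - rd d) + omegabar M (Suc t) (z - rd d)" by simp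
  qed
  then have "alpha M * Ed t (Vf M (Suc t)) y \<le> alpha M * ((\<integral>d. B (Suc t) (y - d) \<partial>dem M t)
      + Ed t (phib 0 (Suc t) (theta M)) z + Ed t (omegabar M (Suc t)) z)"
    using alpha by (intro mult_left_mono) auto
  then show ?thesis unfolding H_rec[OF t] J_def omega_rec(1)[OF t] by (simp add: algebra_simps)
qed

text \<open>Lowering y to w and rounding the demand shift the next level in opposite directions,
  each by at most theta. The net shift is at most one cell, of unknown sign; one barred estimate
  covers both signs.\<close>

lemma H_floor_le_J:
  assumes t: "t + 2 \<le> hor M" and ok: "lower_bound_at (Suc t)"
    and y: "z \<in> Zgrid M" "w \<in> Zgrid M" "w \<le> y" "y \<le> w + theta M" "y \<le> z"
  shows "Hf M t w - J t y \<le> Ccost M t w - Ccost M t y + (psibt t z - gam M t * theta M)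
    + alpha M * Ed t (omegabar M (Suc t)) z"
proof -
  have t': "t < hor M" "Suc t < hor M" using t by auto
  have "Ed t (Vf M (Suc t)) w \<le> (\<integral>d. B (Suc t) (y - d) \<partial>dem M t)
      + Ed t (phib (theta M) (Suc t) (theta M)) z + Ed t (omegabar M (Suc t)) z"
  proof (rule Ed_le_B_expectation[OF t'(1) const_below_V const_below_phib[OF t'(2)] const_below_omegabar[OF t'(2)]])
    fix d :: real assume "0 \<le> d"
    have zd: "z - rd d \<in> Zgrid M" "w - rd d \<in> Zgrid M" using y by (auto intro: Zgrid_diff)
    have "Vf M (Suc t) (w - rd d) - Vf M (Suc t) (y - d) \<le> phibt (Suc t) (z - rd d)"
    proof (cases "y - d \<le> w - rd d")
      case True
      then show ?thesis using y zd rd_less[of d] rd_ge[of d] theta by (intro V_increase[OF t'(2)]) auto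
    next
      case False
      then show ?thesis using y zd rd_less[of d] rd_ge[of d] by (intro V_decrease[OF t'(2)]) auto
    qed
    moreover have "Vf M (Suc t) (y - d) - B (Suc t) (y - d) \<le> omegabar M (Suc t) (z - rd d)"
      using ok y zd rd_less[of d] unfolding lower_bound_at_def by auto
    ultimately show "Vf M (Suc t) (w - rd d) \<le> B (Suc t) (y - d)
        + phibt (Suc t) (z - rd d) + omegabar M (Suc t) (z - rd d)" by simp
  qed
  then have "alpha M * Ed t (Vf M (Suc t)) w \<le> alpha M * ((\<integral>d. B (Suc t) (y - d) \<partial>dem M t)
      + Ed t (phib (theta M) (Suc t) (theta M)) z + Ed t (omegabar M (Suc t)) z)"
    using alpha by (intro mult_left_mono) auto
  then show ?thesis unfolding H_rec[OF t] J_def psib_rec[OF t] by (simp add: algebra_simps)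
qed

text \<open>By convexity C_t cannot rise by more than gamma_t theta in total when one cell is
  traversed upwards and a cell further right is traversed downwards. This is what keeps the
  lower error at a single gamma_t theta.\<close>

lemma Ccost_two_cells:
  assumes t: "t < hor M" and "v \<le> x" "x \<le> v + theta M" "w \<le> y" "y \<le> w + theta M" "x \<le> y"
    and vw: "v = w \<or> v + theta M \<le> w"
  shows "Ccost M t x - Ccost M t v + (Ccost M t w - Ccost M t y) \<le> gam M t * theta M"
proof (cases "v = w")
  case True
  then show ?thesis using Ccost_diff_theta[OF t, of x y] assms by simp
next
  case False
  then have xw: "x \<le> w" using assms by simp
  show ?thesis
  proof (cases "Ccost M t x \<le> Ccost M t v")
    case True
    then show ?thesis using Ccost_diff_theta[OF t, of w y] assms by simp
  next
    case False
    then have "Ccost M t v \<le> Ccost M t y"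
      using Ccost_between(2)[OF t assms(2,6)] by linarith
    then have "Ccost M t w \<le> Ccost M t y"
      using Ccost_between(1)[OF t _ assms(4), of v] assms(2) xw by simp
    then show ?thesis using Ccost_diff_theta[OF t, of x v] assms by simp
  qed
qed

text \<open>This is where eta_t is spent, with all estimates read off at SU, a grid point above x
  and y. Without an order, moving x to the grid costs psibar and rounding costs omega. With an
  order, y moves to its grid floor w (barred phi and omegabar) and x \<ge> s to its floor v (plain
  phi); the grid gives H v \<le> K + H w, and the two changes of C share one gamma_t theta. For x <
  s the comparison of w with S suffices.\<close>

lemma V_le_order_up_to:
  assumes t: "t + 2 \<le> hor M" and ok: "lower_bound_at (Suc t)" and xy: "x \<le> y" "y \<le> SU M t"
  shows "Vf M t x - eta t \<le> setupK M t * delta (y - x) + J t y"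
proof -
  have t': "t < hor M" "Suc t < hor M" using t by auto
  interpret sS_policy "Zgrid M" "setupK M t" "Hf M t" "sf M t" "Sf M t" by (rule policy[OF t])
  let ?U = "SU M t"
  have U: "?U \<in> Zgrid M" by (rule SU_props(1)[OF t'(1)])
  note eta = omega_rec(2)[OF t]
  show ?thesis
  proof (cases "x = y")
    case True
    have HJ: "Hf M t x - omega t ?U \<le> J t x" using H_le_J[OF t ok U, of x] xy by simp
    have "Vf M t x - psibt t ?U \<le> Hf M t x"
    proof (cases "x < sf M t")
      case True
      \<comment> \<open>The inequality H \<ge> H S + K is available only at grid points below s, so
        x is compared with its floor.\<close>
      obtain w where w: "w \<in> Zgrid M" "w \<le> x" "x < w + theta M" by (rule Zgrid_floor)
      have "Hf M t (Sf M t) + setupK M t \<le> Hf M t w" using w True by (intro H_ge_below_s[OF t]) auto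
      moreover have "Hf M t w - Hf M t x \<le> psibt t ?U" using w U xy by (intro H_decrease[OF t]) auto
      ultimately show ?thesis using True by (simp add: Vf_def)
    next
      case False
      then show ?thesis using psib_phib_nonneg(1)[OF t'(1), of "theta M" "theta M" ?U] theta by (simp add: Vf_def)
    qed
    then show ?thesis using HJ True eta by (simp add: delta_def)
  next
    case False
    then have xy': "x < y" using xy by simp
    obtain w where w: "w \<in> Zgrid M" "w \<le> y" "y < w + theta M" by (rule Zgrid_floor)
    have wJ: "Hf M t w - J t y \<le> Ccost M t w - Ccost M t y + (psibt t ?U - gam M t * theta M)
        + alpha M * Ed t (omegabar M (Suc t)) ?U"
      using w xy by (intro H_floor_le_J[OF t ok U]) auto
    have "Vf M t x - eta t \<le> setupK M t + J t y"
    proof (cases "x < sf M t")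
      case True
      have "Hf M t (Sf M t) \<le> Hf M t w" by (rule minS[OF w(1)])
      moreover have "Ccost M t w - Ccost M t y \<le> gam M t * theta M"
        using w by (intro Ccost_diff_theta[OF t'(1)]) auto
      moreover have "0 \<le> alpha M * Ed t (phib 0 (Suc t) (theta M)) ?U"
        using alpha phib_nonneg[OF t'(2)] by (intro mult_nonneg_nonneg Ed_nonneg) auto
      ultimately show ?thesis using wJ True unfolding eta omega_rec(1)[OF t] by (simp add: Vf_def)
    next
      case False
      obtain v where v: "v \<in> Zgrid M" "v \<le> x" "x < v + theta M" by (rule Zgrid_floor)
      \<comment> \<open>As s is a grid point, the floor of x \<ge> s stays at or above s, which
        \<open>H_le_K_plus\<close> requires.\<close>
      have sv: "sf M t \<le> v" using Zgrid_gap[OF v(1) sA] v False by fastforce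
      have vw: "v = w \<or> v + theta M \<le> w"
        using Zgrid_gap[OF v(1) w(1)] Zgrid_gap[OF w(1) v(1)] v w xy by linarith
      then have "v \<le> w" using theta by auto
      then have "Hf M t v \<le> setupK M t + Hf M t w" using v w sv by (intro H_le_K_plus)
      moreover have "Hf M t x - Hf M t v \<le> Ccost M t x - Ccost M t v + (psib 0 t (theta M) ?U - gam M t * theta M)"
        using v xy U by (intro H_increase[OF t t'(2)]) auto
      moreover have "Ccost M t x - Ccost M t v + (Ccost M t w - Ccost M t y) \<le> gam M t * theta M"
        using v w xy vw by (intro Ccost_two_cells[OF t'(1)]) auto
      ultimately show ?thesis
        using wJ False unfolding eta omega_rec(1)[OF t] psib_rec[OF t, of 0] by (simp add: Vf_def)
    qed
    then show ?thesis using xy' by (simp add: delta_def)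
  qed
qed

text \<open>Ordering beyond SU never pays: going back to the grid point below the minimizer (or to x
  itself) saves more than the setup cost, since alpha K_(t+1) \<le> K_t.\<close>

lemma J_le_J_above_SU:
  assumes t: "t + 2 \<le> hor M" and "x \<le> y" "SU M t \<le> y"
  shows "x = zn0 M t \<Longrightarrow> J t x \<le> J t y" "zn0 M t \<le> x \<Longrightarrow> J t x \<le> setupK M t + J t y"
proof -
  have t': "t < hor M" "Suc t < hor M" using t by auto
  interpret prob_space "dem M t" by (rule prob[OF t'(1)])
  have "(\<integral>d. B (Suc t) (x - d) \<partial>dem M t) \<le> (\<integral>d. setupK M (Suc t) + B (Suc t) (y - d) \<partial>dem M t)"
    using B_integrable[OF t'(1)] B_le_K_B[OF t'(2)] assms by (intro integral_mono) auto
  also have "\<dots> = setupK M (Suc t) + (\<integral>d. B (Suc t) (y - d) \<partial>dem M t)"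
    using B_integrable[OF t'(1)] prob_space by simp
  finally have "alpha M * (\<integral>d. B (Suc t) (x - d) \<partial>dem M t)
      \<le> alpha M * (setupK M (Suc t) + (\<integral>d. B (Suc t) (y - d) \<partial>dem M t))"
    using alpha by (intro mult_left_mono) auto
  then have le: "J t x \<le> Ccost M t x - Ccost M t y + setupK M t + J t y"
    using Kdec[OF t] by (simp add: J_def algebra_simps)
  have C: "Ccost M t (zn0 M t) + setupK M t < Ccost M t y" by (rule Ccost_above_SU[OF t'(1) assms(3)])
  show "x = zn0 M t \<Longrightarrow> J t x \<le> J t y" using le C by simp
  assume "zn0 M t \<le> x"
  then have "Ccost M t x \<le> Ccost M t y"
    using Ccost_between(1)[OF t'(1), of "zn0 M t" x y] C Kpos[OF t'(1)] assms by simp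
  then show "J t x \<le> setupK M t + J t y" using le by simp
qed

text \<open>For x \<le> SU a level y beyond SU is traded for \<open>zn0\<close> or for x itself,
  after which eta_t suffices. For x beyond SU not ordering is best and only rounding at the level x
  counts; this is why omega_t enters the maximum in omegabar.\<close>

lemma lower_bound_at: "t < hor M \<Longrightarrow> lower_bound_at t"
proof (induction rule: backward_induct)
  case last
  show ?case unfolding lower_bound_at_def by (simp del: One_nat_def add: B_last omegabar_last)
next
  case (step t)
  note t = step(1)
  have t': "t < hor M" using t by simp
  show ?case
    unfolding lower_bound_at_def
  proof (intro allI impI)
    fix x z assume z: "z \<in> Zgrid M" "x \<le> z"
    have "Vf M t x - omegabar M t z \<le> B t x"
    proof (rule B_ge[OF t'])
      fix y assume xy: "x \<le> y"
      show "Vf M t x - omegabar M t z \<le> setupK M t * delta (y - x) + J t y"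
      proof (cases "x \<le> SU M t")
        case True
        have "Vf M t x - eta t \<le> setupK M t * delta (y - x) + J t y"
        proof (cases "y \<le> SU M t")
          case True
          then show ?thesis using xy by (intro V_le_order_up_to[OF step]) auto
        next
          case False
          then have d: "delta (y - x) = 1" using \<open>x \<le> SU M t\<close> by (simp add: delta_def)
          show ?thesis
          proof (cases "x \<le> zn0 M t")
            case True
            have "Vf M t x - eta t \<le> setupK M t * delta (zn0 M t - x) + J t (zn0 M t)"
              using True zn0_less_SU[OF t'] by (intro V_le_order_up_to[OF step]) auto
            moreover have "setupK M t * delta (zn0 M t - x) \<le> setupK M t"
              using Kpos[OF t'] delta_le_1 by (simp add: mult_left_le)
            moreover have "J t (zn0 M t) \<le> J t y"
              using False zn0_less_SU[OF t'] by (intro J_le_J_above_SU(1)[OF t]) auto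
            ultimately show ?thesis using d by simp
          next
            case x: False
            have "Vf M t x - eta t \<le> setupK M t * delta (x - x) + J t x"
              using \<open>x \<le> SU M t\<close> by (intro V_le_order_up_to[OF step]) auto
            moreover have "J t x \<le> setupK M t + J t y"
              using False x xy by (intro J_le_J_above_SU(2)[OF t]) auto
            ultimately show ?thesis using d by (simp add: delta_def)
          qed
        qed
        moreover have "eta t \<le> omegabar M t z" by (simp add: omegabar_rec[OF t])
        ultimately show ?thesis by simp
      next
        case False
        have "omega t z \<le> omegabar M t z" using False z by (simp add: omegabar_rec[OF t])
        moreover have "Vf M t x = Hf M t x"
          using False s_props(3)[OF t] S_props(3)[OF t] by (simp add: Vf_def)
        moreover have "Hf M t x - J t x \<le> omega t z" by (rule H_le_J[OF step z])
        moreover have "J t x \<le> setupK M t * delta (y - x) + J t y"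
          using J_le_J_above_SU(2)[OF t xy] False xy zn0_less_SU[OF t']
          by (cases "x = y") (auto simp: delta_def)
        ultimately show ?thesis by simp
      qed
    qed
    then show "Vf M t x - B t x \<le> omegabar M t z" by simp
  qed
qed

section \<open>Upper error bound\<close>

lemma B_le_policy_cost:
  assumes t: "t + 2 \<le> hor M"
    and JH: "\<And>y. y \<le> max z (Sf M t) \<Longrightarrow> J t y - Hf M t y \<le> e" and x: "x \<le> z"
  shows "B t x - Vf M t x \<le> e"
proof -
  have t': "t < hor M" using t by simp
  show ?thesis
  \<comment> \<open>Following the approximate policy from x \<le> z leads to S or leaves x, so only
    levels up to max z S matter; this is the origin of the maxima in lambda and epsilon.\<close>
  proof (cases "x < sf M t")
    case True
    then show ?thesis
      using B_le_K_J[OF t', of x "Sf M t"] s_props(3)[OF t] JH[of "Sf M t"] by (simp add: Vf_def)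
  next
    case False
    have "x \<le> max z (Sf M t)" using x by simp
    then show ?thesis using B_le_J[OF t', of x] JH[of x] False by (simp add: Vf_def)
  qed
qed

text \<open>The next period is the last one, where B = V is Lipschitz without a jump; rounding
  therefore costs a single alpha gamma_{T-1} theta.\<close>

lemma upper_last:
  assumes t: "t + 2 = hor M"
  shows "J t y - Hf M t y \<le> alpha M * gam M (hor M - 1) * theta M"
proof -
  have t': "t < hor M" "t + 2 \<le> hor M" and Suc: "Suc t = hor M - 1" using t by auto
  have "(\<integral>d. B (Suc t) (y - d) \<partial>dem M t)
      \<le> Ed t (Vf M (Suc t)) y + 0 * Ed t (Vf M (Suc t)) y + gam M (Suc t) * theta M"
  proof (rule B_expectation_le[OF t'(1) const_below_V const_below_V])
    fix d :: real assume "0 \<le> d"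
    have "Vf M (Suc t) (y - d) - Vf M (Suc t) (y - rd d) \<le> gam M (Suc t) * \<bar>(y - d) - (y - rd d)\<bar>"
      using V_last_lipschitz[of "y - d" "y - rd d"] unfolding Suc by linarith
    also have "\<dots> \<le> gam M (Suc t) * theta M"
      using gam[of "Suc t"] t rd_less[of d] rd_ge[of d] by (intro mult_left_mono) auto
    finally show "B (Suc t) (y - d) \<le> Vf M (Suc t) (y - rd d) + 0 * Vf M (Suc t) (y - rd d) + gam M (Suc t) * theta M"
      unfolding Suc B_last by simp
  qed
  then have "alpha M * (\<integral>d. B (Suc t) (y - d) \<partial>dem M t)
      \<le> alpha M * (Ed t (Vf M (Suc t)) y + gam M (Suc t) * theta M)"
    using alpha by (intro mult_left_mono) auto
  then show ?thesis unfolding J_def H_rec[OF t'(2)] Suc[symmetric] by (simp add: algebra_simps)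
qed

text \<open>C cancels at a common level, which leaves twice the expectation of the barred phi, that
  is, twice psibar minus gamma_t theta. The factor 2 comes from levels y - d off the grid.\<close>

lemma upper_step:
  assumes t: "t + 3 \<le> hor M"
    and IH: "\<And>x. x \<le> z + theta M \<Longrightarrow> B (Suc t) x - Vf M (Suc t) x \<le> e"
    and y: "z \<in> Zgrid M" "y \<le> z"
  shows "J t y - Hf M t y \<le> 2 * (psibt t z - gam M t * theta M) + alpha M * e"
proof -
  have t': "t < hor M" "t + 2 \<le> hor M" "Suc t < hor M" using t by auto
  have "(\<integral>d. B (Suc t) (y - d) \<partial>dem M t)
      \<le> Ed t (Vf M (Suc t)) y + 2 * Ed t (phib (theta M) (Suc t) (theta M)) z + e"
  proof (rule B_expectation_le[OF t'(1) const_below_V const_below_phib[OF t'(3)]])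
    fix d :: real assume d: "0 \<le> d"
    have "Vf M (Suc t) (y - d) - Vf M (Suc t) (y - rd d) \<le> 2 * phibt (Suc t) (z - rd d)"
      using y rd_less[of d] rd_ge[of d] Zgrid_diff[OF y(1) rd_Zgrid]
      by (intro V_decrease_off_grid[OF t'(3)]) auto
    moreover have "B (Suc t) (y - d) - Vf M (Suc t) (y - d) \<le> e"
      using d y theta by (intro IH) auto
    ultimately show "B (Suc t) (y - d) \<le> Vf M (Suc t) (y - rd d) + 2 * phibt (Suc t) (z - rd d) + e"
      by simp
  qed
  then have "alpha M * (\<integral>d. B (Suc t) (y - d) \<partial>dem M t)
      \<le> alpha M * (Ed t (Vf M (Suc t)) y + 2 * Ed t (phib (theta M) (Suc t) (theta M)) z + e)"
    using alpha by (intro mult_left_mono) auto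
  then show ?thesis unfolding J_def H_rec[OF t'(2)] psib_rec[OF t'(2)] by (simp add: algebra_simps)
qed

lemma upper_bound:
  assumes "t \<le> hor M - 2" "z \<in> Zgrid M" "x \<le> z"
  shows "B t x - Vf M t x \<le> epsbar M t z"
  using assms
proof (induction arbitrary: x z rule: inc_induct)
  case base
  have t: "hor M - 2 + 2 = hor M" using hor by simp
  show ?case
    using upper_last[OF t] t base.prems by (intro B_le_policy_cost[where z = z]) (auto simp: epsbar_last[OF t])
next
  case (step t)
  have t: "t + 3 \<le> hor M" "t + 2 \<le> hor M" using step.hyps by auto
  have S: "Sf M t \<in> Zgrid M" using S_props(1)[OF t(2)] .
  let ?z = "max z (Sf M t)"
  have z: "?z \<in> Zgrid M" using S step.prems by (simp add: max_def)
  show ?case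
  proof (rule B_le_policy_cost[OF t(2) _ step.prems(2)])
    fix y assume "y \<le> ?z"
    then show "J t y - Hf M t y \<le> epsbar M t z"
      unfolding epsbar_rec[OF t(1)] using z step.IH[OF Zgrid_add_theta[OF z]]
      by (intro upper_step[OF t(1)]) auto
  qed
qed

lemma value_error_bounds:
  assumes z: "z \<in> Zgrid M" "x \<le> z"
  shows "- omegabar M 0 z \<le> vopt M 0 x - (Vf M 0 x - cst M 0 * x)"
    and "vopt M 0 x - (Vf M 0 x - cst M 0 * x) \<le> epsbar M 0 z"
proof -
  have "lower_bound_at 0" using hor by (intro lower_bound_at) auto
  then have "Vf M 0 x - B 0 x \<le> omegabar M 0 z" using z by (simp add: lower_bound_at_def)
  then show "- omegabar M 0 z \<le> vopt M 0 x - (Vf M 0 x - cst M 0 * x)" by (simp add: B_def)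
  show "vopt M 0 x - (Vf M 0 x - cst M 0 * x) \<le> epsbar M 0 z"
    using upper_bound[of 0 z x] z hor by (simp add: B_def)
qed

end

theorem theorem4p7:
  fixes M :: invmodel and x :: real and k :: int
  assumes hor: "hor M \<ge> 2"
    and alpha: "0 < alpha M" "alpha M \<le> 1"
    and theta: "theta M > 0"
    and Kpos: "\<forall>t < hor M. setupK M t \<ge> 0"
    and Kdec: "\<forall>t. t + 2 \<le> hor M \<longrightarrow> setupK M t \<ge> alpha M * setupK M (Suc t)"
    and prob: "\<forall>t < hor M. prob_space (dem M t)"
    and borel: "\<forall>t < hor M. sets (dem M t) = sets borel"
    and nonneg: "\<forall>t < hor M. AE d in dem M t. d \<ge> 0"
    and mean: "\<forall>t < hor M. integrable (dem M t) (\<lambda>d. d)"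
    and finexp: "\<forall>t < hor M. \<forall>y. integrable (dem M t) (\<lambda>d. vopt M (Suc t) (y - d))"
    and convex: "\<forall>t < hor M. convex_on UNIV (Ccost M t)"
    and coer: "\<forall>t < hor M. filterlim (Ccost M t) at_top at_top \<and> filterlim (Ccost M t) at_top at_bot"
    and gam: "\<forall>t < hor M. gam M t \<ge> 0"
    and lip: "\<forall>t < hor M. \<forall>u w. \<bar>Ccost M t u - Ccost M t w\<bar> \<le> gam M t * \<bar>u - w\<bar>"
    and x: "zg M (k - 1) < x" "x \<le> zg M k"
  shows "- omegabar M 0 (zg M k) \<le> vopt M 0 x - (Vf M 0 x - cst M 0 * x)
         \<and> vopt M 0 x - (Vf M 0 x - cst M 0 * x) \<le> epsbar M 0 (zg M k)"
proof -
  interpret grid_inventory M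
    proof (rule grid_inventory.intro)
    fix t y u w
    show "2 \<le> hor M" by (rule hor)
    show "0 < alpha M" "alpha M \<le> 1" by (rule alpha)+
    show "0 < theta M" by (rule theta)
    show "t + 2 \<le> hor M \<Longrightarrow> alpha M * setupK M (Suc t) \<le> setupK M t" using Kdec by blast
    assume t: "t < hor M"
    show "0 \<le> setupK M t" "prob_space (dem M t)" "sets (dem M t) = sets borel"
      "AE d in dem M t. 0 \<le> d" "integrable (dem M t) (\<lambda>d. d)"
      "integrable (dem M t) (\<lambda>d. vopt M (Suc t) (y - d))"
      "convex_on UNIV (Ccost M t)" "filterlim (Ccost M t) at_top at_top"
      "filterlim (Ccost M t) at_top at_bot" "0 \<le> gam M t"
      "\<bar>Ccost M t u - Ccost M t w\<bar> \<le> gam M t * \<bar>u - w\<bar>"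
      using t Kpos prob borel nonneg mean finexp convex coer gam lip by blast+
  qed
  show ?thesis
    using value_error_bounds[of "zg M k" x] x(2) by simp
qed

end
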